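(* Assume Assumptions 1 and 2, fix $T\ge1$, and let $\pi_0$ either admit a density or be a point mass $\delta_{x_0}$. Set $J^T_T\equiv0$ and for $t=T-1,\dots,0$ define $$J^T_t(\pi)=\inf_{Q\in\mathcal Q_c}\Big(\tfrac1T c(\pi,Q)+\sum_{m=1}^M J^T_{t+1}\big(\hat\pi(m,\pi,Q)\big)\,\pi(Q^{-1}(m))\Big),$$ (terms with $\pi(Q^{-1}(m))=0$ being zero). Then for every $t\ge1$ and $\pi\in\mathcal S$, and for $t=0$ and $\pi\in\mathcal S\cup\{\pi_0\}$, the infimum is attained by some $Q\in\mathcal Q_c$. Moreover, $J^T_t$ is continuous on $\mathcal S$.
   Context: Assumption 1: the source is $x_{t+1}=f(x_t,w_t)$ with $f:\mathbb R^d\times\mathbb R^d\to\mathbb R^d$ Borel, $\{w_t\}$ i.i.d. and independent of $x_0\sim\pi_0$; for each $x$ the law of $f(x,w_0)$ has a density $\phi(\cdot|x)$ which is strictly positive everywhere, bounded by $C$ and $C_1$-Lipschitz, uniformly in $x$. Assumption 2: $c_0:\mathbb R^d\times\mathbb U\to\mathbb R$ is nonnegative, bounded and continuous, and the reconstruction set $\mathbb U$ is compact. $\mathcal S$: probability measures on $\mathbb R^d$ with density bounded by $C$ and $C_1$-Lipschitz, with the weak (equivalently, total variation) topology. $M$-cell quantizer: Borel $Q:\mathbb R^d\to\{1,\dots,M\}$; $\mathcal Q_c$: quantizers with all cells $Q^{-1}(i)$ convex, topologized by: fix $P$ with strictly positive density, identify $Q,Q'$ if $PQ=PQ'$, and $Q_n\to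 Q$ iff $PQ_n\to PQ$ weakly, where $PQ(A\times\{i\})=P(A\cap Q^{-1}(i))$. Cost: $c(\pi,Q)=\sum_{i=1}^M\inf_{u\in\mathbb U}\int_{Q^{-1}(i)}c_0(x,u)\pi(dx)$. Filter update: $\hat\pi(m,\pi,Q)$ is the probability measure with density $z\mapsto\pi(Q^{-1}(m))^{-1}\int_{Q^{-1}(m)}\phi(z|x)\pi(dx)$ when $\pi(Q^{-1}(m))>0$. *)

theory Defs
  imports "HOL-Probability.Probability"
begin

text \<open>The state space R^d is modelled by an arbitrary Euclidean space type 'a.
  Probability measures on R^d are values of type 'a measure.\<close>

definition dens_class :: "real \<Rightarrow> real \<Rightarrow> ('a::euclidean_space) measure set" where
  "dens_class C C1 = {\<pi>. prob_space \<pi> \<and>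
     (\<exists>g. g \<in> borel_measurable borel \<and> \<pi> = density lborel (\<lambda>x. ennreal (g x)) \<and>
          (\<forall>x. 0 \<le> g x \<and> g x \<le> C) \<and> (\<forall>x y. \<bar>g x - g y\<bar> \<le> C1 * dist x y))}"

definition weak_conv_seq :: "(nat \<Rightarrow> ('a::euclidean_space) measure) \<Rightarrow> 'a measure \<Rightarrow> bool" where
  "weak_conv_seq \<mu>s \<mu> \<longleftrightarrow>
     (\<forall>g::'a \<Rightarrow> real. continuous_on UNIV g \<and> bounded (range g) \<longrightarrow>
        (\<lambda>n. \<integral>x. g x \<partial>(\<mu>s n)) \<longlonglongrightarrow> (\<integral>x. g x \<partial>\<mu>))"

definition quantizers_c :: "nat \<Rightarrow> (('a::euclidean_space) \<Rightarrow> nat) set" where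
  "quantizers_c M = {Q. Q \<in> borel_measurable borel \<and> (\<forall>x. Q x \<in> {1..M}) \<and>
                        (\<forall>i\<in>{1..M}. convex (Q -` {i}))}"

definition qcost :: "nat \<Rightarrow> ('a::euclidean_space \<Rightarrow> 'u \<Rightarrow> real) \<Rightarrow> 'u set \<Rightarrow> 'a measure \<Rightarrow> ('a \<Rightarrow> nat) \<Rightarrow> real" where
  "qcost M c0 U \<pi> Q = (\<Sum>i=1..M. INF u\<in>U. \<integral>x. indicator (Q -` {i}) x * c0 x u \<partial>\<pi>)"

text \<open>Filter update; phi x z is the transition density phi(z|x).\<close>
definition filter_update :: "('a::euclidean_space \<Rightarrow> 'a \<Rightarrow> real) \<Rightarrow> nat \<Rightarrow> 'a measure \<Rightarrow> ('a \<Rightarrow> nat) \<Rightarrow> 'a measure" where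
  "filter_update \<phi> m \<pi> Q = density lborel
     (\<lambda>z. ennreal ((\<integral>x. indicator (Q -` {m}) x * \<phi> x z \<partial>\<pi>) / measure \<pi> (Q -` {m})))"

definition stage_obj :: "nat \<Rightarrow> ('a::euclidean_space \<Rightarrow> 'u \<Rightarrow> real) \<Rightarrow> 'u set \<Rightarrow> ('a \<Rightarrow> 'a \<Rightarrow> real) \<Rightarrow> nat
    \<Rightarrow> ('a measure \<Rightarrow> real) \<Rightarrow> 'a measure \<Rightarrow> ('a \<Rightarrow> nat) \<Rightarrow> real" where
  "stage_obj M c0 U \<phi> T Jn \<pi> Q =
     (1 / real T) * qcost M c0 U \<pi> Q +
     (\<Sum>m=1..M. if measure \<pi> (Q -` {m}) = 0 then 0
                 else Jn (filter_update \<phi> m \<pi> Q) * measure \<pi> (Q -` {m}))"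

primrec Jrem :: "nat \<Rightarrow> ('a::euclidean_space \<Rightarrow> 'u \<Rightarrow> real) \<Rightarrow> 'u set \<Rightarrow> ('a \<Rightarrow> 'a \<Rightarrow> real) \<Rightarrow> nat
    \<Rightarrow> nat \<Rightarrow> 'a measure \<Rightarrow> real" where
  "Jrem M c0 U \<phi> T 0 = (\<lambda>\<pi>. 0)"
| "Jrem M c0 U \<phi> T (Suc n) =
     (\<lambda>\<pi>. INF Q\<in>quantizers_c M. stage_obj M c0 U \<phi> T (Jrem M c0 U \<phi> T n) \<pi> Q)"

definition JT :: "nat \<Rightarrow> ('a::euclidean_space \<Rightarrow> 'u \<Rightarrow> real) \<Rightarrow> 'u set \<Rightarrow> ('a \<Rightarrow> 'a \<Rightarrow> real) \<Rightarrow> nat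
    \<Rightarrow> nat \<Rightarrow> 'a measure \<Rightarrow> real" where
  "JT M c0 U \<phi> T t = Jrem M c0 U \<phi> T (T - t)"

end

theory Submission
  imports Defs "HOL-Complex_Analysis.Great_Picard"
begin

text \<open>
  The key point is a compactness property of quantizers with convex cells: every sequence of them
  has a subsequence that converges pointwise at \<^emph>\<open>every\<close> point, which is stronger than weak
  convergence of \<open>PQ\<^sub>n\<close> and makes the limit automatically Borel with convex cells. A diagonal argument
  makes the labels converge on a countable dense set. The points whose label stabilizes at \<open>i\<close> form a
  convex set, and a point whose label does not stabilize lies in the closures of two of these disjoint
  convex sets, hence in one of finitely many proper affine subspaces, where one argues by induction on
  the dimension.

  By dominated convergence the stage cost and the filter update are then jointly continuous in the
  quantizer and in the measure, the latter with respect to total variation. Hence the values of the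
  stage objective form a compact set, and as the measure varies the objective converges uniformly on
  the quantizers, so that its infimum is continuous. On the class \<open>\<S>\<close> weak convergence forces
  pointwise convergence of the equi-Lipschitz densities, which are recovered by averaging against
  small tents, and Scheffe's lemma turns this into convergence in total variation.
\<close>

section \<open>Compactness of convex quantizers\<close>

definition stabilizes_on :: "'a set \<Rightarrow> (nat \<Rightarrow> 'a \<Rightarrow> 'b) \<Rightarrow> ('a \<Rightarrow> 'b) \<Rightarrow> bool" where
  "stabilizes_on A Qs Q \<longleftrightarrow> (\<forall>x\<in>A. \<forall>\<^sub>F n in sequentially. Qs n x = Q x)"

lemma ex_stabilizes_on_iff:
  "(\<exists>Q. stabilizes_on A Qs Q) \<longleftrightarrow> (\<forall>x\<in>A. \<exists>i. \<forall>\<^sub>F n in sequentially. Qs n x = i)"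
  unfolding stabilizes_on_def by (rule bchoice_iff[symmetric])

lemma ex_stabilizes_on_Un:
  assumes "stabilizes_on A Qs Q" "stabilizes_on B Qs Q'"
  shows "\<exists>Q. stabilizes_on (A \<union> B) Qs Q"
proof -
  have "\<forall>x\<in>A \<union> B. \<exists>i. \<forall>\<^sub>F n in sequentially. Qs n x = i"
    using assms unfolding stabilizes_on_def by blast
  then show ?thesis by (simp only: ex_stabilizes_on_iff)
qed

lemma stabilizes_on_limit_mem:
  assumes "stabilizes_on A Qs Q" "x \<in> A" "\<And>n. Qs n x \<in> I"
  shows "Q x \<in> I"
proof -
  obtain n where "Qs n x = Q x"
    using assms(1,2) eventually_happens'[OF sequentially_bot] unfolding stabilizes_on_def by blast
  then show ?thesis using assms(3) by metis
qed

lemma stabilizes_on_eventually_label_iff: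
  assumes "stabilizes_on A Qs Q" "x \<in> A"
  shows "(\<forall>\<^sub>F n in sequentially. Qs n x = i) \<longleftrightarrow> Q x = i"
proof
  assume "\<forall>\<^sub>F n in sequentially. Qs n x = i"
  moreover have "\<forall>\<^sub>F n in sequentially. Qs n x = Q x"
    using assms by (simp add: stabilizes_on_def)
  ultimately have "\<forall>\<^sub>F n in sequentially. Q x = i"
    by eventually_elim simp
  then show "Q x = i" by simp
qed (use assms in \<open>auto simp: stabilizes_on_def\<close>)

lemma stabilizes_on_subseq:
  assumes "stabilizes_on A Qs Q" "strict_mono r"
  shows "stabilizes_on A (\<lambda>n. Qs (r n)) Q"
  using assms(1) eventually_subseq[OF assms(2)] unfolding stabilizes_on_def by blast

lemma eventually_eq_limit_finite_range:
  fixes g :: "nat \<Rightarrow> 'a::t1_space"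
  assumes "g \<longlonglongrightarrow> l" "finite S" "\<And>n. g n \<in> S"
  shows "\<forall>\<^sub>F n in sequentially. g n = l"
proof -
  have "open (- (S - {l}))"
    using \<open>finite S\<close> by (intro open_Compl finite_imp_closed finite_Diff)
  then have "\<forall>\<^sub>F n in sequentially. g n \<in> - (S - {l})"
    by (intro topological_tendstoD[OF assms(1)]) auto
  then show ?thesis
    by (rule eventually_mono) (use assms(3) in auto)
qed

lemma stabilizing_subsequence_countable:
  fixes Qs :: "nat \<Rightarrow> 'a \<Rightarrow> 'b"
  assumes "countable D" "finite I" "\<And>n x. Qs n x \<in> I"
  shows "\<exists>r Q. strict_mono r \<and> stabilizes_on D (\<lambda>n. Qs (r n)) Q"
proof -
  define code where "code i = real (to_nat_on I i)" for i
  have code_inj: "inj_on code I"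
    using inj_on_to_nat_on[OF countable_finite[OF \<open>finite I\<close>]] by (auto simp: code_def inj_on_def)
  have "norm (code (Qs n x)) \<le> Max (code ` I)" for n x
    using assms(2,3) by (auto simp: code_def intro!: Max_ge)
  then obtain r :: "nat \<Rightarrow> nat" where r: "strict_mono r"
    and conv: "\<And>x. x \<in> D \<Longrightarrow> \<exists>l. (\<lambda>n. code (Qs (r n) x)) \<longlonglongrightarrow> l"
    using function_convergent_subsequence[OF \<open>countable D\<close>, of "\<lambda>n x. code (Qs n x)"] by blast
  have "\<exists>i. \<forall>\<^sub>F n in sequentially. Qs (r n) x = i" if x: "x \<in> D" for x
  proof -
    obtain l where "(\<lambda>n. code (Qs (r n) x)) \<longlonglongrightarrow> l" using conv[OF x] by blast
    then have "\<forall>\<^sub>F n in sequentially. code (Qs (r n) x) = l"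
      using assms(2,3) by (intro eventually_eq_limit_finite_range[where S = "code ` I"]) auto
    then have "\<forall>\<^sub>F n in sequentially. Qs (r n) x = the_inv_into I code l"
      by (rule eventually_mono) (use the_inv_into_f_f[OF code_inj] assms(3) in auto)
    then show ?thesis by blast
  qed
  then show ?thesis
    using r ex_stabilizes_on_iff[of D "\<lambda>n. Qs (r n)"] by blast
qed

lemma stabilizing_subsequence_Union:
  fixes Qs :: "nat \<Rightarrow> 'a \<Rightarrow> 'b"
  assumes "finite \<A>"
    and "\<And>A r. A \<in> \<A> \<Longrightarrow> strict_mono (r :: nat \<Rightarrow> nat) \<Longrightarrow>
      \<exists>s Q. strict_mono s \<and> stabilizes_on A (\<lambda>n. Qs (r (s n))) Q"
  shows "\<exists>r Q. strict_mono r \<and> stabilizes_on (\<Union>\<A>) (\<lambda>n. Qs (r n)) Q"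
  using assms
proof (induction \<A> rule: finite_induct)
  case empty
  show ?case using strict_mono_id by (auto simp: stabilizes_on_def)
next
  case (insert A \<A>)
  then obtain r Q where r: "strict_mono r" "stabilizes_on (\<Union>\<A>) (\<lambda>n. Qs (r n)) Q"
    by (metis insertI2)
  obtain s Q' where s: "strict_mono s" "stabilizes_on A (\<lambda>n. Qs (r (s n))) Q'"
    using insert.prems[OF insertI1 r(1)] by blast
  have "\<exists>Q. stabilizes_on (\<Union>(insert A \<A>)) (\<lambda>n. Qs (r (s n))) Q"
    using ex_stabilizes_on_Un[OF s(2) stabilizes_on_subseq[OF r(2) s(1)]] by simp
  then show ?case
    using strict_mono_o[OF r(1) s(1)] by (auto simp: o_def)
qed

lemma convex_eventually_label:
  assumes "\<And>n. convex (Qs n -` {i})"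
  shows "convex {x. \<forall>\<^sub>F n in F. Qs n x = i}"
proof (rule convexI)
  fix x y and u v :: real
  assume "x \<in> {x. \<forall>\<^sub>F n in F. Qs n x = i}" "y \<in> {x. \<forall>\<^sub>F n in F. Qs n x = i}"
    and uv: "0 \<le> u" "0 \<le> v" "u + v = 1"
  then have "\<forall>\<^sub>F n in F. Qs n x = i \<and> Qs n y = i"
    by (simp add: eventually_conj)
  then have "\<forall>\<^sub>F n in F. Qs n (u *\<^sub>R x + v *\<^sub>R y) = i"
  proof (rule eventually_mono)
    fix n assume "Qs n x = i \<and> Qs n y = i"
    then have "u *\<^sub>R x + v *\<^sub>R y \<in> Qs n -` {i}"
      by (intro convexD[OF assms _ _ uv]) auto
    then show "Qs n (u *\<^sub>R x + v *\<^sub>R y) = i" by simp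
  qed
  then show "u *\<^sub>R x + v *\<^sub>R y \<in> {x. \<forall>\<^sub>F n in F. Qs n x = i}" by simp
qed

lemma properly_separating_hyperplane:
  fixes S T :: "'a::euclidean_space set"
  assumes "convex S" "convex T" "S \<noteq> {}" "T \<noteq> {}" "S \<inter> T = {}"
  obtains a x y where "\<And>x y. x \<in> S \<Longrightarrow> y \<in> T \<Longrightarrow> a \<bullet> y \<le> a \<bullet> x"
    and "x \<in> S" "y \<in> T" "a \<bullet> x \<noteq> a \<bullet> y"
proof -
  define D where "D = (\<Union>x\<in>S. \<Union>y\<in>T. {x - y})"
  have "convex D" "D \<noteq> {}" "0 \<notin> D"
    using assms by (auto simp: D_def intro!: convex_differences)
  then obtain a where a: "a \<in> span D" "a \<noteq> 0" "\<And>d. d \<in> D \<Longrightarrow> 0 \<le> a \<bullet> d"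
    by (rule separating_hyperplane_set_0_inspan) blast
  have "\<exists>d\<in>D. a \<bullet> d \<noteq> 0"
  proof (rule ccontr)
    assume "\<not> ?thesis"
    then have "a \<bullet> a = 0"
      using orthogonal_to_span[OF a(1), of a] by (simp add: orthogonal_def)
    then show False using a(2) by simp
  qed
  then obtain x y where xy: "x \<in> S" "y \<in> T" "a \<bullet> x \<noteq> a \<bullet> y"
    by (auto simp: D_def inner_diff_right)
  have "a \<bullet> q \<le> a \<bullet> p" if "p \<in> S" "q \<in> T" for p q
    using a(3)[of "p - q"] that by (auto simp: D_def inner_diff_right)
  then show thesis using xy by (rule that)
qed

lemma aff_dim_closure_Int_closure_less:
  fixes S T :: "'a::euclidean_space set"
  assumes "convex S" "convex T" "S \<inter> T = {}" "S \<noteq> {}"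
  shows "aff_dim (closure S \<inter> closure T) < aff_dim (S \<union> T)"
proof (cases "closure S \<inter> closure T = {}")
  case True
  then show ?thesis
    using assms(4) aff_dim_geq[of "S \<union> T"] aff_dim_empty[of "S \<union> T"] by simp
next
  case False
  let ?H = "closure S \<inter> closure T"
  from False obtain h where h: "h \<in> ?H" by blast
  then have "T \<noteq> {}" by auto
  then obtain a x y where sep: "\<And>x y. x \<in> S \<Longrightarrow> y \<in> T \<Longrightarrow> a \<bullet> y \<le> a \<bullet> x"
    and xy: "x \<in> S" "y \<in> T" "a \<bullet> x \<noteq> a \<bullet> y"
    using properly_separating_hyperplane[OF assms(1,2,4) _ assms(3)] by blast
  have "a \<bullet> q \<le> a \<bullet> p" if "p \<in> closure S" "q \<in> closure T" for p q
  proof -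
    have "a \<bullet> z \<le> a \<bullet> p" if "z \<in> T" for z
      using closure_minimal[of S "{w. a \<bullet> z \<le> a \<bullet> w}"] sep that \<open>p \<in> closure S\<close>
      by (auto simp: closed_halfspace_ge)
    then show ?thesis
      using closure_minimal[of T "{w. a \<bullet> w \<le> a \<bullet> p}"] \<open>q \<in> closure T\<close>
      by (auto simp: closed_halfspace_le)
  qed
  then have "?H \<subseteq> {z. a \<bullet> z = a \<bullet> h}"
    using h by (auto intro: antisym)
  then have hull_H: "affine hull ?H \<subseteq> {z. a \<bullet> z = a \<bullet> h}"
    by (simp add: hull_minimal affine_hyperplane)
  have "affine hull ?H \<subseteq> affine hull (S \<union> T)"
  proof (rule hull_minimal)
    show "?H \<subseteq> affine hull (S \<union> T)"
      using closure_affine_hull[of S] hull_mono[of S "S \<union> T" affine] by auto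
  qed simp
  moreover have "x \<in> affine hull (S \<union> T)" "y \<in> affine hull (S \<union> T)"
    using xy by (auto intro: hull_inc)
  ultimately have "affine hull ?H \<subset> affine hull (S \<union> T)"
    using hull_H xy(3) by (metis (mono_tags, lifting) mem_Collect_eq psubsetI subsetD)
  then show ?thesis by (rule aff_dim_psubset)
qed

lemma dense_convex_cover_uncovered_point:
  fixes E :: "'i \<Rightarrow> 'a::euclidean_space set"
  assumes "affine A" "finite I" and E: "\<And>i. i \<in> I \<Longrightarrow> convex (E i)" "\<And>i. i \<in> I \<Longrightarrow> E i \<subseteq> A"
    and dense: "A \<subseteq> closure (\<Union>i\<in>I. E i)"
    and x: "x \<in> A" "x \<notin> (\<Union>i\<in>I. E i)"
  obtains i j where "i \<in> I" "j \<in> I" "i \<noteq> j" "x \<in> closure (E i) \<inter> closure (E j)"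
proof -
  have "closure (\<Union>i\<in>I. E i) \<subseteq> (\<Union>i\<in>I. closure (E i))"
    using \<open>finite I\<close> closure_subset by (intro closure_minimal closed_UN) auto
  then have cover: "A \<subseteq> (\<Union>i\<in>I. closure (E i))" using dense by blast
  then obtain i where i: "i \<in> I" "x \<in> closure (E i)" using x(1) by blast
  \<comment> \<open>If \<open>x\<close> avoided the other closures, it would lie in
    \<open>rel_interior (closure (E i)) = rel_interior (E i)\<close>.\<close>
  define W where "W = - (\<Union>j\<in>I - {i}. closure (E j))"
  have "open W" unfolding W_def using \<open>finite I\<close> by (intro open_Compl closed_UN) auto
  have "x \<notin> W"
  proof
    assume "x \<in> W"
    have "closure (E i) \<subseteq> A"
      using E(2)[OF i(1)] by (intro closure_minimal affine_closed \<open>affine A\<close>)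
    then have "affine hull closure (E i) \<subseteq> A"
      using \<open>affine A\<close> by (rule hull_minimal)
    then have "W \<inter> affine hull closure (E i) \<subseteq> closure (E i)"
      using cover by (auto simp: W_def)
    then have "x \<in> rel_interior (closure (E i))"
      using \<open>open W\<close> \<open>x \<in> W\<close> i(2) by (auto simp: mem_rel_interior)
    then have "x \<in> E i"
      using rel_interior_subset by (auto simp: convex_rel_interior_closure[OF E(1)[OF i(1)]])
    then show False using x(2) i(1) by blast
  qed
  then show thesis using i that by (auto simp: W_def)
qed

lemma dense_convex_cover_lower_dimension:
  fixes E :: "'i \<Rightarrow> 'a::euclidean_space set"
  assumes "affine A" "finite I" and E: "\<And>i. convex (E i)" "\<And>i. E i \<subseteq> A"
    and disjoint: "\<And>i j. i \<noteq> j \<Longrightarrow> E i \<inter> E j = {}"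
    and dense: "A \<subseteq> closure (\<Union>i\<in>I. E i)"
  obtains \<B> where "finite \<B>" "\<forall>B\<in>\<B>. affine B \<and> aff_dim B < aff_dim A" "A - \<Union>\<B> \<subseteq> (\<Union>i\<in>I. E i)"
proof -
  define \<B> where "\<B> = (\<lambda>(i, j). affine hull (closure (E i) \<inter> closure (E j))) `
    {(i, j) \<in> I \<times> I. i \<noteq> j \<and> E i \<noteq> {}}"
  have "finite \<B>"
    unfolding \<B>_def using \<open>finite I\<close>
    by (intro finite_imageI rev_finite_subset[OF finite_cartesian_product]) auto
  moreover have "\<forall>B\<in>\<B>. affine B \<and> aff_dim B < aff_dim A"
  proof
    fix B assume "B \<in> \<B>"
    then obtain i j where ij: "i \<noteq> j" "E i \<noteq> {}"
      and B: "B = affine hull (closure (E i) \<inter> closure (E j))"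
      by (auto simp: \<B>_def)
    have "aff_dim B < aff_dim (E i \<union> E j)"
      unfolding B aff_dim_affine_hull
      by (intro aff_dim_closure_Int_closure_less E disjoint ij)
    also have "\<dots> \<le> aff_dim A"
      by (intro aff_dim_subset Un_least E)
    finally show "affine B \<and> aff_dim B < aff_dim A" by (simp add: B)
  qed
  moreover have "A - \<Union>\<B> \<subseteq> (\<Union>i\<in>I. E i)"
  proof (rule subsetI, rule ccontr)
    fix x assume x: "x \<in> A - \<Union>\<B>" and uncovered: "x \<notin> (\<Union>i\<in>I. E i)"
    obtain i j where "i \<in> I" "j \<in> I" "i \<noteq> j" and closures: "x \<in> closure (E i) \<inter> closure (E j)"
      by (rule dense_convex_cover_uncovered_point[OF assms(1,2) E dense DiffD1[OF x] uncovered])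
    moreover have "E i \<noteq> {}" using closures by auto
    ultimately have "affine hull (closure (E i) \<inter> closure (E j)) \<in> \<B>"
      unfolding \<B>_def by (intro image_eqI[of _ _ "(i, j)"]) auto
    then show False
      using hull_inc[OF closures] x by blast
  qed
  ultimately show thesis by (rule that)
qed

lemma stabilizes_off_lower_dimension:
  fixes Qs :: "nat \<Rightarrow> 'a::euclidean_space \<Rightarrow> 'b"
  assumes "affine A" "finite I" and label: "\<And>n x. Qs n x \<in> I" and conv: "\<And>n i. convex (Qs n -` {i})"
    and D: "D \<subseteq> A" "A \<subseteq> closure D" "stabilizes_on D Qs Q"
  obtains \<B> Q' where "finite \<B>" "\<forall>B\<in>\<B>. affine B \<and> aff_dim B < aff_dim A"
    "stabilizes_on (A - \<Union>\<B>) Qs Q'"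
proof -
  define E where "E i = A \<inter> {x. \<forall>\<^sub>F n in sequentially. Qs n x = i}" for i
  have E_convex: "convex (E i)" for i
    unfolding E_def
    by (intro convex_Int affine_imp_convex[OF \<open>affine A\<close>] convex_eventually_label conv)
  have E_subset: "E i \<subseteq> A" for i
    by (simp add: E_def)
  have E_disjoint: "E i \<inter> E j = {}" if "i \<noteq> j" for i j
  proof -
    have False
      if "\<forall>\<^sub>F n in sequentially. Qs n x = i" "\<forall>\<^sub>F n in sequentially. Qs n x = j" for x
      using eventually_happens'[OF sequentially_bot eventually_conj[OF that]] \<open>i \<noteq> j\<close> by metis
    then show ?thesis by (auto simp: E_def)
  qed
  have "x \<in> E (Q x)" "Q x \<in> I" if "x \<in> D" for x
    using that D stabilizes_on_limit_mem[OF D(3) that label] by (auto simp: E_def stabilizes_on_def)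
  then have E_dense: "A \<subseteq> closure (\<Union>i\<in>I. E i)"
    using D(2) closure_mono[of D "\<Union>i\<in>I. E i"] by blast
  obtain \<B> where \<B>: "finite \<B>" "\<forall>B\<in>\<B>. affine B \<and> aff_dim B < aff_dim A"
    and "A - \<Union>\<B> \<subseteq> (\<Union>i\<in>I. E i)"
    by (rule dense_convex_cover_lower_dimension[OF assms(1,2) E_convex E_subset E_disjoint E_dense])
  then have "\<forall>x\<in>A - \<Union>\<B>. \<exists>i. \<forall>\<^sub>F n in sequentially. Qs n x = i"
    by (auto simp: E_def)
  then obtain Q' where "stabilizes_on (A - \<Union>\<B>) Qs Q'"
    unfolding ex_stabilizes_on_iff[symmetric] by blast
  with \<B> show thesis by (rule that)
qed

lemma stabilizing_subsequence_affine:
  fixes Qs :: "nat \<Rightarrow> 'a::euclidean_space \<Rightarrow> 'b"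
  assumes "affine A" "finite I" "\<And>n x. Qs n x \<in> I" "\<And>n i. convex (Qs n -` {i})"
  shows "\<exists>r Q. strict_mono r \<and> stabilizes_on A (\<lambda>n. Qs (r n)) Q"
  using assms
proof (induction "nat (aff_dim A + 1)" arbitrary: A Qs rule: less_induct)
  case less
  obtain D where D: "countable D" "D \<subseteq> A" "A \<subseteq> closure D"
    by (rule separable)
  obtain r Q where r: "strict_mono r" and Q: "stabilizes_on D (\<lambda>n. Qs (r n)) Q"
    using stabilizing_subsequence_countable[OF D(1) less.prems(2), of Qs] less.prems(3) by blast
  obtain \<B> Q_off where \<B>: "finite \<B>" "\<forall>B\<in>\<B>. affine B \<and> aff_dim B < aff_dim A"
    and Q_off: "stabilizes_on (A - \<Union>\<B>) (\<lambda>n. Qs (r n)) Q_off"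
    by (rule stabilizes_off_lower_dimension[OF less.prems D(2,3) Q])
  have "\<exists>s Q. strict_mono s \<and> stabilizes_on B (\<lambda>n. Qs (r (r' (s n)))) Q"
    if "B \<in> \<B>" "strict_mono r'" for B and r' :: "nat \<Rightarrow> nat"
  proof (rule less.hyps[of B "\<lambda>n. Qs (r (r' n))"])
    show "nat (aff_dim B + 1) < nat (aff_dim A + 1)"
      using \<B>(2) \<open>B \<in> \<B>\<close> aff_dim_geq[of B] by force
  qed (use less.prems(2-4) \<B>(2) \<open>B \<in> \<B>\<close> in simp_all)
  then obtain s Q_on where s: "strict_mono s" and Q_on: "stabilizes_on (\<Union>\<B>) (\<lambda>n. Qs (r (s n))) Q_on"
    using stabilizing_subsequence_Union[OF \<B>(1), of "\<lambda>n. Qs (r n)"] by blast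
  obtain Q' where "stabilizes_on ((A - \<Union>\<B>) \<union> \<Union>\<B>) (\<lambda>n. Qs (r (s n))) Q'"
    using ex_stabilizes_on_Un[OF stabilizes_on_subseq[OF Q_off s] Q_on] by blast
  then have "stabilizes_on A (\<lambda>n. Qs (r (s n))) Q'"
    by (simp add: stabilizes_on_def)
  then show ?case using strict_mono_o[OF r s] by (auto simp: o_def)
qed

lemma cell_borel:
  fixes Q :: "'a::topological_space \<Rightarrow> 'b::t1_space"
  assumes "Q \<in> borel_measurable borel"
  shows "Q -` {i} \<in> sets borel"
  by (intro measurable_sets_borel[OF assms] borel_closed finite_imp_closed) simp

lemma stabilizes_on_quantizers_c:
  assumes Qs: "\<And>n. Qs n \<in> quantizers_c M" and lim: "stabilizes_on UNIV Qs Q"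
  shows "Q \<in> quantizers_c M"
proof -
  have cell_eq: "Q -` {i} = {x. \<forall>\<^sub>F n in sequentially. Qs n x = i}" for i
    by (auto simp: stabilizes_on_eventually_label_iff[OF lim])
  have range: "Q x \<in> {1..M}" for x
    using Qs by (intro stabilizes_on_limit_mem[OF lim]) (auto simp: quantizers_c_def)
  have [measurable]: "Qs n -` {i} \<in> sets borel" for n i
    using Qs by (auto simp: quantizers_c_def intro: cell_borel)
  have "Q -` {i} \<in> sets borel" for i
  proof -
    have "Q -` {i} = (\<Union>N. \<Inter>n\<in>{N..}. Qs n -` {i})"
      unfolding cell_eq eventually_sequentially by auto
    then show ?thesis by simp
  qed
  then have "Q \<in> borel \<rightarrow>\<^sub>M count_space UNIV"
    by (intro measurable_count_space_eq2_countable[THEN iffD2]) auto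
  then have "Q \<in> borel_measurable borel"
    by (simp add: measurable_cong_sets[OF refl sets_borel_eq_count_space])
  moreover have "convex (Q -` {i})" if "i \<in> {1..M}" for i
    using Qs that unfolding cell_eq by (intro convex_eventually_label) (auto simp: quantizers_c_def)
  ultimately show ?thesis using range by (simp add: quantizers_c_def)
qed

lemma quantizers_c_convergent_subsequence:
  fixes Qs :: "nat \<Rightarrow> 'a::euclidean_space \<Rightarrow> nat"
  assumes Qs: "\<And>n. Qs n \<in> quantizers_c M"
  obtains r Q where "strict_mono r" "Q \<in> quantizers_c M" "stabilizes_on UNIV (\<lambda>n. Qs (r n)) Q"
proof -
  have range: "Qs n x \<in> {1..M}" for n x
    using Qs unfolding quantizers_c_def by blast
  have convex_cell: "convex (Qs n -` {i})" for n i
  proof (cases "i \<in> {1..M}")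
    case True
    then show ?thesis using Qs unfolding quantizers_c_def by blast
  next
    case False
    then have "Qs n -` {i} = {}" using range by blast
    then show ?thesis by simp
  qed
  have "\<exists>r Q. strict_mono r \<and> stabilizes_on UNIV (\<lambda>n. Qs (r n)) Q"
    by (rule stabilizing_subsequence_affine[OF affine_UNIV finite_atLeastAtMost range convex_cell])
  then obtain r Q where r: "strict_mono r" and lim: "stabilizes_on UNIV (\<lambda>n. Qs (r n)) Q"
    by blast
  show thesis
    using r stabilizes_on_quantizers_c[OF Qs lim] lim by (rule that)
qed

lemma quantizers_c_nonempty:
  assumes "1 \<le> M"
  shows "(quantizers_c M :: ('a::euclidean_space \<Rightarrow> nat) set) \<noteq> {}"
proof -
  have "convex ((\<lambda>_. 1 :: nat) -` {i} :: 'a set)" for i by (cases "i = 1") auto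
  then have "(\<lambda>_. 1) \<in> (quantizers_c M :: ('a \<Rightarrow> nat) set)"
    using assms by (simp add: quantizers_c_def)
  then show ?thesis by blast
qed

section \<open>Convergence in total variation\<close>

lemma uniform_limitI_dist_le:
  assumes "\<And>n x. x \<in> S \<Longrightarrow> dist (f n x) (l x) \<le> e n" "(e \<longlongrightarrow> 0) F"
  shows "uniform_limit S f l F"
proof (rule uniform_limitI)
  fix \<epsilon> :: real assume "0 < \<epsilon>"
  with assms(2) have "\<forall>\<^sub>F n in F. e n < \<epsilon>" by (rule order_tendstoD)
  then show "\<forall>\<^sub>F n in F. \<forall>x\<in>S. dist (f n x) (l x) < \<epsilon>"
    by (rule eventually_mono) (use assms(1) in \<open>blast intro: le_less_trans\<close>)
qed

definition bounded_borel :: "real \<Rightarrow> ('a::topological_space \<Rightarrow> real) set" where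
  "bounded_borel B = {h \<in> borel_measurable borel. \<forall>x. \<bar>h x\<bar> \<le> B}"

lemma bounded_borel_mult:
  assumes "k \<in> bounded_borel A" "h \<in> bounded_borel B"
  shows "(\<lambda>x. k x * h x) \<in> bounded_borel (A * B)"
proof -
  have "\<bar>k x * h x\<bar> \<le> A * B" for x
    unfolding abs_mult
    using assms
    by (intro mult_mono) (auto simp: bounded_borel_def intro: order_trans[OF abs_ge_zero])
  then show ?thesis
    using assms by (auto simp: bounded_borel_def intro!: borel_measurable_times)
qed

lemma integrable_bounded_borel:
  assumes "\<pi> \<in> space (prob_algebra borel)" "h \<in> bounded_borel B"
  shows "integrable \<pi> h"
proof -
  interpret prob_space \<pi> using assms(1) by (simp add: space_prob_algebra)
  have [measurable_cong]: "sets \<pi> = sets borel" using assms(1) by (simp add: space_prob_algebra)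
  show ?thesis
    using assms(2) by (intro integrable_const_bound[where B = B]) (auto simp: bounded_borel_def)
qed

lemma abs_integral_bounded_borel:
  assumes \<pi>: "\<pi> \<in> space (prob_algebra borel)" and h: "h \<in> bounded_borel B"
  shows "\<bar>\<integral>x. h x \<partial>\<pi>\<bar> \<le> B"
proof -
  interpret prob_space \<pi> using \<pi> by (simp add: space_prob_algebra)
  have "\<bar>\<integral>x. h x \<partial>\<pi>\<bar> \<le> (\<integral>x. \<bar>h x\<bar> \<partial>\<pi>)" by (rule integral_abs_bound)
  also have "\<dots> \<le> B"
    using h integrable_bounded_borel[OF \<pi> h]
    by (intro integral_le_const integrable_abs) (auto simp: bounded_borel_def)
  finally show ?thesis .
qed

definition tv_conv :: "(nat \<Rightarrow> 'a::topological_space measure) \<Rightarrow> 'a measure \<Rightarrow> bool" where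
  "tv_conv \<mu>s \<mu> \<longleftrightarrow> (\<forall>B. uniform_limit (bounded_borel B)
     (\<lambda>n h. \<integral>x. h x \<partial>\<mu>s n) (\<lambda>h. \<integral>x. h x \<partial>\<mu>) sequentially)"

lemma tv_conv_const: "tv_conv (\<lambda>_. \<mu>) \<mu>"
  by (simp add: tv_conv_def uniform_limit_const)

lemma tv_conv_subseq:
  assumes "tv_conv \<mu>s \<mu>" "strict_mono r"
  shows "tv_conv (\<lambda>n. \<mu>s (r n)) \<mu>"
  using assms(1) filterlim_compose[OF _ filterlim_subseq[OF assms(2)]]
  unfolding tv_conv_def by blast

lemma integrable_nonneg_density:
  assumes [measurable]: "f \<in> borel_measurable M" and "\<And>x. 0 \<le> f x"
    and "prob_space (density M (\<lambda>x. ennreal (f x)))"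
  shows "integrable M f" "(\<integral>\<^sup>+x. ennreal (f x) \<partial>M) = 1"
proof -
  show mass: "(\<integral>\<^sup>+x. ennreal (f x) \<partial>M) = 1"
    using prob_space.emeasure_space_1[OF assms(3)]
    by (simp add: emeasure_density cong: nn_integral_cong)
  show "integrable M f"
    using mass assms(2) by (intro integrableI_nonneg) auto
qed

lemma densities_L1_tendsto:
  fixes f :: "'a \<Rightarrow> real"
  assumes [measurable]: "\<And>n. fs n \<in> borel_measurable M" "f \<in> borel_measurable M"
    and nonneg: "\<And>n x. 0 \<le> fs n x" "\<And>x. 0 \<le> f x"
    and prob: "\<And>n. prob_space (density M (\<lambda>x. ennreal (fs n x)))"
      "prob_space (density M (\<lambda>x. ennreal (f x)))"
    and lim: "\<And>x. (\<lambda>n. fs n x) \<longlonglongrightarrow> f x"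
  shows "(\<lambda>n. \<integral>x. \<bar>fs n x - f x\<bar> \<partial>M) \<longlonglongrightarrow> 0"
proof -
  note fs_int = integrable_nonneg_density[OF assms(1) nonneg(1) prob(1)]
  note f_int = integrable_nonneg_density[OF assms(2) nonneg(2) prob(2)]
  have "(\<lambda>n. \<integral>\<^sup>+x. norm (fs n x - f x) \<partial>M) \<longlonglongrightarrow> 0"
    using lim nonneg fs_int f_int by (intro Scheffe_lemma2) auto
  moreover have "(\<integral>\<^sup>+x. norm (fs n x - f x) \<partial>M) = ennreal (\<integral>x. \<bar>fs n x - f x\<bar> \<partial>M)" for n
    using f_int(1) fs_int(1)[of n] by (subst nn_integral_eq_integral) auto
  ultimately have "(\<lambda>n. ennreal (\<integral>x. \<bar>fs n x - f x\<bar> \<partial>M)) \<longlonglongrightarrow> ennreal 0" by simp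
  then show ?thesis by (subst (asm) tendsto_ennreal_iff) auto
qed

lemma integral_mult_diff_le:
  fixes f g h :: "'a \<Rightarrow> real"
  assumes int: "integrable M f" "integrable M g"
    and h: "h \<in> borel_measurable M" "\<And>x. \<bar>h x\<bar> \<le> B"
  shows "\<bar>(\<integral>x. f x * h x \<partial>M) - (\<integral>x. g x * h x \<partial>M)\<bar> \<le> B * (\<integral>x. \<bar>f x - g x\<bar> \<partial>M)"
proof -
  have abs_mult_le: "\<bar>k x * h x\<bar> \<le> B * \<bar>k x\<bar>" for k :: "'a \<Rightarrow> real" and x
    using h(2)[of x] by (simp add: abs_mult mult.commute[of B] mult_left_mono)
  have mult_int: "integrable M (\<lambda>x. k x * h x)" if "integrable M k" for k :: "'a \<Rightarrow> real"
  proof (rule Bochner_Integration.integrable_bound)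
    show "integrable M (\<lambda>x. B * \<bar>k x\<bar>)" using that by simp
    have "norm (k x * h x) \<le> norm (B * \<bar>k x\<bar>)" for x
      unfolding real_norm_def by (rule order_trans[OF abs_mult_le abs_ge_self])
    then show "AE x in M. norm (k x * h x) \<le> norm (B * \<bar>k x\<bar>)" by simp
    show "(\<lambda>x. k x * h x) \<in> borel_measurable M"
      using that h(1) by (intro borel_measurable_times) auto
  qed
  have "(\<integral>x. f x * h x \<partial>M) - (\<integral>x. g x * h x \<partial>M) = (\<integral>x. (f x - g x) * h x \<partial>M)"
    using mult_int[OF int(1)] mult_int[OF int(2)] by (simp add: left_diff_distrib)
  also have "\<bar>\<dots>\<bar> \<le> (\<integral>x. B * \<bar>f x - g x\<bar> \<partial>M)"
  proof (rule order_trans[OF integral_abs_bound integral_mono])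
    show "integrable M (\<lambda>x. \<bar>(f x - g x) * h x\<bar>)"
      using int by (intro integrable_abs mult_int Bochner_Integration.integrable_diff)
    show "integrable M (\<lambda>x. B * \<bar>f x - g x\<bar>)" using int by simp
  qed (rule abs_mult_le)
  finally show ?thesis by simp
qed

abbreviation real_density :: "('a::euclidean_space \<Rightarrow> real) \<Rightarrow> 'a measure" where
  "real_density g \<equiv> density lborel (\<lambda>x. ennreal (g x))"

lemma tv_conv_densities:
  fixes g :: "'a::euclidean_space \<Rightarrow> real"
  assumes [measurable]: "\<And>n. gs n \<in> borel_measurable borel" "g \<in> borel_measurable borel"
    and nonneg: "\<And>n x. 0 \<le> gs n x" "\<And>x. 0 \<le> g x"
    and prob: "\<And>n. prob_space (real_density (gs n))" "prob_space (real_density g)"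
    and lim: "\<And>x. (\<lambda>n. gs n x) \<longlonglongrightarrow> g x"
  shows "tv_conv (\<lambda>n. real_density (gs n)) (real_density g)"
  unfolding tv_conv_def
proof (intro allI uniform_limitI_dist_le)
  fix B :: real
  show "(\<lambda>n. B * (\<integral>x. \<bar>gs n x - g x\<bar> \<partial>lborel)) \<longlonglongrightarrow> 0"
    using tendsto_mult_left[OF densities_L1_tendsto[OF _ _ nonneg prob lim], of B] by simp
  have int: "integrable lborel (gs n)" "integrable lborel g" for n
    using nonneg prob by (auto intro!: integrable_nonneg_density)
  fix n and h :: "'a \<Rightarrow> real" assume "h \<in> bounded_borel B"
  then have [measurable]: "h \<in> borel_measurable borel" and "\<And>x. \<bar>h x\<bar> \<le> B"
    by (auto simp: bounded_borel_def)
  then have "\<bar>(\<integral>x. gs n x * h x \<partial>lborel) - (\<integral>x. g x * h x \<partial>lborel)\<bar>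
      \<le> B * (\<integral>x. \<bar>gs n x - g x\<bar> \<partial>lborel)"
    using int by (intro integral_mult_diff_le) auto
  then show "dist (\<integral>x. h x \<partial>real_density (gs n)) (\<integral>x. h x \<partial>real_density g)
      \<le> B * (\<integral>x. \<bar>gs n x - g x\<bar> \<partial>lborel)"
    using nonneg by (simp add: integral_density dist_real_def)
qed

lemma uniform_limit_integral_weights:
  fixes k :: "nat \<Rightarrow> 'a::topological_space \<Rightarrow> real"
  assumes "finite_measure \<mu>" and sets_\<mu>: "sets \<mu> = sets borel"
    and [measurable]: "\<And>n. k n \<in> borel_measurable borel"
    and k_le: "\<And>n x. \<bar>k n x\<bar> \<le> 1" and lim: "\<And>x. (\<lambda>n. k n x) \<longlonglongrightarrow> k' x"
  shows "uniform_limit (bounded_borel B)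
    (\<lambda>n h. \<integral>x. k n x * h x \<partial>\<mu>) (\<lambda>h. \<integral>x. k' x * h x \<partial>\<mu>) sequentially"
proof (rule uniform_limitI_dist_le)
  interpret finite_measure \<mu> by fact
  note [measurable_cong] = sets_\<mu>
  have [measurable]: "k' \<in> borel_measurable borel"
    by (rule borel_measurable_LIMSEQ_real[OF lim]) simp
  have k'_le: "\<bar>k' x\<bar> \<le> 1" for x
    by (rule LIMSEQ_le_const2[OF tendsto_rabs[OF lim]]) (use k_le in blast)
  have "(\<lambda>n. \<integral>x. \<bar>k n x - k' x\<bar> \<partial>\<mu>) \<longlonglongrightarrow> (\<integral>x. 0 \<partial>\<mu>)"
  proof (rule integral_dominated_convergence[where w = "\<lambda>_. 2"])
    show "AE x in \<mu>. (\<lambda>n. \<bar>k n x - k' x\<bar>) \<longlonglongrightarrow> 0"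
      by (intro AE_I2 tendsto_rabs_zero LIM_zero lim)
    have "\<bar>k n x - k' x\<bar> \<le> 2" for n x
      using k_le[of n x] k'_le[of x] by linarith
    then show "AE x in \<mu>. norm \<bar>k n x - k' x\<bar> \<le> 2" for n by simp
  qed auto
  then show "(\<lambda>n. B * (\<integral>x. \<bar>k n x - k' x\<bar> \<partial>\<mu>)) \<longlonglongrightarrow> 0"
    by (intro tendsto_mult_right_zero) simp
  fix n and h :: "'a \<Rightarrow> real" assume h: "h \<in> bounded_borel B"
  have "integrable \<mu> (k n)" "integrable \<mu> k'"
    using k_le k'_le by (auto intro!: integrable_const_bound[where B = 1])
  moreover have "h \<in> borel_measurable \<mu>" "\<And>x. \<bar>h x\<bar> \<le> B"
    using h by (auto simp: bounded_borel_def measurable_cong_sets[OF sets_\<mu> refl])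
  ultimately show "dist (\<integral>x. k n x * h x \<partial>\<mu>) (\<integral>x. k' x * h x \<partial>\<mu>) \<le> B * (\<integral>x. \<bar>k n x - k' x\<bar> \<partial>\<mu>)"
    unfolding dist_real_def by (rule integral_mult_diff_le)
qed

lemma uniform_limit_weighted_integral:
  fixes k :: "nat \<Rightarrow> 'a::topological_space \<Rightarrow> real"
  assumes tv: "tv_conv \<mu>s \<mu>" and \<mu>: "finite_measure \<mu>" "sets \<mu> = sets borel"
    and k: "\<And>n. k n \<in> bounded_borel 1" "\<And>x. (\<lambda>n. k n x) \<longlonglongrightarrow> k' x"
  shows "uniform_limit (bounded_borel B)
    (\<lambda>n h. \<integral>x. k n x * h x \<partial>\<mu>s n) (\<lambda>h. \<integral>x. k' x * h x \<partial>\<mu>) sequentially"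
proof -
  have "uniform_limit (bounded_borel B)
    (\<lambda>n h. (\<integral>x. k n x * h x \<partial>\<mu>s n) - (\<integral>x. k n x * h x \<partial>\<mu>)) (\<lambda>_. 0) sequentially"
  proof (rule uniform_limitI)
    fix e :: real assume "0 < e"
    with tv have "\<forall>\<^sub>F n in sequentially. \<forall>h\<in>bounded_borel B. dist (\<integral>x. h x \<partial>\<mu>s n) (\<integral>x. h x \<partial>\<mu>) < e"
      unfolding tv_conv_def by (intro uniform_limitD) auto
    then show "\<forall>\<^sub>F n in sequentially. \<forall>h\<in>bounded_borel B.
        dist ((\<integral>x. k n x * h x \<partial>\<mu>s n) - (\<integral>x. k n x * h x \<partial>\<mu>)) 0 < e"
    proof eventually_elim
      case (elim n)
      have "(\<lambda>x. k n x * h x) \<in> bounded_borel B" if "h \<in> bounded_borel B" for h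
        using bounded_borel_mult[OF k(1)[of n] that] by simp
      then show ?case using elim by (simp add: dist_real_def)
    qed
  qed
  moreover have "uniform_limit (bounded_borel B)
    (\<lambda>n h. \<integral>x. k n x * h x \<partial>\<mu>) (\<lambda>h. \<integral>x. k' x * h x \<partial>\<mu>) sequentially"
    using k by (intro uniform_limit_integral_weights \<mu>) (auto simp: bounded_borel_def)
  ultimately have "uniform_limit (bounded_borel B)
    (\<lambda>n h. ((\<integral>x. k n x * h x \<partial>\<mu>s n) - (\<integral>x. k n x * h x \<partial>\<mu>)) + (\<integral>x. k n x * h x \<partial>\<mu>))
    (\<lambda>h. 0 + (\<integral>x. k' x * h x \<partial>\<mu>)) sequentially"
    by (rule uniform_limit_add)
  then show ?thesis by simp
qed

section \<open>Densities with a common Lipschitz constant\<close>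

lemma lipschitz_on_UNIV_iff:
  fixes f :: "'a::{metric_space, perfect_space} \<Rightarrow> 'b::metric_space"
  shows "L-lipschitz_on UNIV f \<longleftrightarrow> (\<forall>x y. dist (f x) (f y) \<le> L * dist x y)"
proof
  assume lip: "\<forall>x y. dist (f x) (f y) \<le> L * dist x y"
  obtain x y :: 'a where "x \<noteq> y"
    using UNIV_not_singleton by (metis UNIV_eq_I singletonI)
  moreover have "0 \<le> L * dist x y"
    using lip by (meson order_trans zero_le_dist)
  ultimately have "0 \<le> L" by (simp add: zero_le_mult_iff)
  then show "L-lipschitz_on UNIV f" using lip by (simp add: lipschitz_onI)
qed (simp add: lipschitz_onD)

lemma lipschitz_on_borel_measurable: "L-lipschitz_on UNIV f \<Longrightarrow> f \<in> borel_measurable borel"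
  by (intro borel_measurable_continuous_onI lipschitz_on_continuous_on)

definition tent :: "real \<Rightarrow> 'a::euclidean_space \<Rightarrow> 'a \<Rightarrow> real" where
  "tent r x y = max 0 (1 - dist x y / r)"

definition tent_mean :: "real \<Rightarrow> 'a::euclidean_space measure \<Rightarrow> 'a \<Rightarrow> real" where
  "tent_mean r \<mu> x = (\<integral>y. tent r x y \<partial>\<mu>) / (\<integral>y. tent r x y \<partial>lborel)"

lemma tent_nonneg: "0 \<le> tent r x y"
  by (simp add: tent_def)

lemma tent_le_1: "0 < r \<Longrightarrow> tent r x y \<le> 1"
  by (simp add: tent_def)

lemma tent_eq_0: "0 < r \<Longrightarrow> r \<le> dist x y \<Longrightarrow> tent r x y = 0"
  by (simp add: tent_def field_simps)

lemma continuous_on_tent: "r \<noteq> 0 \<Longrightarrow> continuous_on S (tent r x)"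
  unfolding tent_def by (intro continuous_intros) auto

lemma tent_measurable [measurable]: "(\<lambda>(x, y). tent r x y) \<in> borel_measurable (borel \<Otimes>\<^sub>M borel)"
  unfolding tent_def by measurable

lemma integrable_tent_mult:
  assumes r: "0 < r" and "continuous_on UNIV g"
  shows "integrable lborel (\<lambda>y. tent r x y * (g y :: real))"
proof -
  have "continuous_on (cball x r) g"
    using assms(2) by (rule continuous_on_subset) simp
  then have "integrable lborel (\<lambda>y. indicator (cball x r) y *\<^sub>R (tent r x y * g y))"
    using r by (intro borel_integrable_compact continuous_intros continuous_on_tent) auto
  also have "(\<lambda>y. indicator (cball x r) y *\<^sub>R (tent r x y * g y)) = (\<lambda>y. tent r x y * g y)"
    using tent_eq_0[OF r, of x] by (auto simp: fun_eq_iff indicator_def)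
  finally show ?thesis .
qed

lemma integrable_tent: "0 < r \<Longrightarrow> integrable lborel (tent r x)"
  using integrable_tent_mult[of r "\<lambda>_. 1" x] by simp

lemma integral_tent_pos:
  fixes x :: "'a::euclidean_space"
  assumes r: "0 < r"
  shows "0 < (\<integral>y. tent r x y \<partial>lborel)"
proof -
  have "0 < measure lborel (ball x (r / 2)) / 2"
    using content_ball_pos[of "r / 2" x] r by simp
  also have "\<dots> = (\<integral>y. indicator (ball x (r / 2)) y / 2 \<partial>lborel)" by simp
  also have "\<dots> \<le> (\<integral>y. tent r x y \<partial>lborel)"
  proof (rule integral_mono)
    have "emeasure lborel (ball x (r / 2)) < \<infinity>" by (rule emeasure_lborel_ball_finite)
    then show "integrable lborel (\<lambda>y. indicator (ball x (r / 2)) y / 2 :: real)"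
      by (intro integrable_divide integrable_real_indicator) auto
    show "integrable lborel (tent r x)" by (rule integrable_tent[OF r])
    show "indicator (ball x (r / 2)) y / 2 \<le> tent r x y" for y
      using r by (auto simp: tent_def indicator_def field_simps)
  qed
  finally show ?thesis .
qed

lemma abs_tent_mult_diff_le:
  assumes r: "0 < r" and g: "L-lipschitz_on UNIV g"
  shows "\<bar>tent r x y * (g y - g x)\<bar> \<le> tent r x y * (L * r)"
proof (cases "dist x y \<le> r")
  case True
  have "\<bar>g y - g x\<bar> \<le> L * dist y x"
    using lipschitz_onD[OF g] by (simp add: dist_real_def)
  also have "\<dots> \<le> L * r"
    using True lipschitz_on_nonneg[OF g] by (intro mult_left_mono) (auto simp: dist_commute)
  finally show ?thesis by (simp add: abs_mult tent_nonneg mult_left_mono)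
next
  case False
  then show ?thesis by (simp add: tent_eq_0[OF r])
qed

lemma tent_mean_density_dist_le:
  assumes r: "0 < r" and g: "L-lipschitz_on UNIV g" "\<And>y. 0 \<le> g y"
  shows "dist (tent_mean r (real_density g) x) (g x) \<le> L * r"
proof -
  define mass where "mass = (\<integral>y. tent r x y \<partial>lborel)"
  have mass_pos: "0 < mass" unfolding mass_def by (rule integral_tent_pos[OF r])
  note [measurable] = lipschitz_on_borel_measurable[OF g(1)]
  note int = integrable_tent[OF r, of x]
    integrable_tent_mult[OF r lipschitz_on_continuous_on[OF g(1)], of x]
  have "(\<integral>y. tent r x y \<partial>real_density g) = (\<integral>y. tent r x y * g y \<partial>lborel)"
    using g(2) by (subst integral_density) (auto simp: mult.commute)
  then have "tent_mean r (real_density g) x - g x =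
      ((\<integral>y. tent r x y * g y \<partial>lborel) - mass * g x) / mass"
    using mass_pos by (simp add: tent_mean_def mass_def field_simps)
  also have "\<dots> = (\<integral>y. tent r x y * (g y - g x) \<partial>lborel) / mass"
    using int by (simp add: mass_def right_diff_distrib)
  also have "\<bar>\<dots>\<bar> \<le> (\<integral>y. tent r x y * (L * r) \<partial>lborel) / mass"
  proof -
    have "\<bar>\<integral>y. tent r x y * (g y - g x) \<partial>lborel\<bar> \<le> (\<integral>y. tent r x y * (L * r) \<partial>lborel)"
    proof (rule order_trans[OF integral_abs_bound integral_mono])
      show "integrable lborel (\<lambda>y. \<bar>tent r x y * (g y - g x)\<bar>)"
        using int by (simp add: right_diff_distrib)
      show "integrable lborel (\<lambda>y. tent r x y * (L * r))" using int by auto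
    qed (rule abs_tent_mult_diff_le[OF r g(1)])
    then show ?thesis using mass_pos by (simp add: divide_right_mono)
  qed
  also have "\<dots> = L * r" using mass_pos by (simp add: mass_def)
  finally show ?thesis by (simp add: dist_real_def)
qed

lemma uniform_limit_tent_mean:
  assumes "\<And>i. i \<in> S \<Longrightarrow> L-lipschitz_on UNIV (g i)" "\<And>i y. i \<in> S \<Longrightarrow> 0 \<le> g i y"
  shows "uniform_limit S (\<lambda>k i. tent_mean (inverse (real (Suc k))) (real_density (g i)) x)
    (\<lambda>i. g i x) sequentially"
proof (rule uniform_limitI_dist_le)
  show "(\<lambda>k. L * inverse (real (Suc k))) \<longlonglongrightarrow> 0"
    using tendsto_mult_left[OF LIMSEQ_inverse_real_of_nat, of L] by simp
qed (use assms in \<open>intro tent_mean_density_dist_le, auto\<close>)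

lemma tent_mean_weakly_continuous:
  assumes "weak_conv_seq \<mu>s \<mu>" "0 < r"
  shows "(\<lambda>n. tent_mean r (\<mu>s n) x) \<longlonglongrightarrow> tent_mean r \<mu> x"
  unfolding tent_mean_def
proof (intro tendsto_divide tendsto_const)
  have "continuous_on UNIV (tent r x) \<and> bounded (range (tent r x))"
    using assms(2) tent_le_1[OF assms(2)]
    by (auto simp: bounded_iff abs_of_nonneg[OF tent_nonneg] intro!: exI[of _ 1] continuous_on_tent)
  then show "(\<lambda>n. \<integral>y. tent r x y \<partial>\<mu>s n) \<longlonglongrightarrow> (\<integral>y. tent r x y \<partial>\<mu>)"
    using assms(1) unfolding weak_conv_seq_def by blast
  show "(\<integral>y. tent r x y \<partial>lborel) \<noteq> 0"
    using integral_tent_pos[OF assms(2), of x] by simp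
qed

lemma weak_conv_lipschitz_densities_pointwise:
  assumes weak: "weak_conv_seq (\<lambda>n. real_density (gs n)) (real_density g)"
    and gs: "\<And>n. L-lipschitz_on UNIV (gs n)" "\<And>n y. 0 \<le> gs n y"
    and g: "L-lipschitz_on UNIV g" "\<And>y. 0 \<le> g y"
  shows "(\<lambda>n. gs n x) \<longlonglongrightarrow> g x"
proof (rule swap_uniform_limit')
  define m where "m k h = tent_mean (inverse (real (Suc k))) (real_density h) x"
    for k and h :: "'a \<Rightarrow> real"
  show "\<forall>\<^sub>F k in sequentially. (\<lambda>n. m k (gs n)) \<longlonglongrightarrow> m k g"
    unfolding m_def by (intro always_eventually allI tent_mean_weakly_continuous[OF weak]) simp
  show "(\<lambda>k. m k g) \<longlonglongrightarrow> g x"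
    unfolding m_def using g
    by (intro tendsto_uniform_limitI[OF uniform_limit_tent_mean[of "{g}" L "\<lambda>g. g"]]) auto
  show "uniform_limit UNIV (\<lambda>k n. m k (gs n)) (\<lambda>n. gs n x) sequentially"
    unfolding m_def using gs by (intro uniform_limit_tent_mean) auto
qed auto

lemma dens_class_iff:
  fixes \<pi> :: "'a::euclidean_space measure"
  shows "\<pi> \<in> dens_class C C1 \<longleftrightarrow> prob_space \<pi> \<and>
    (\<exists>g. \<pi> = real_density g \<and> (\<forall>x. 0 \<le> g x \<and> g x \<le> C) \<and> C1-lipschitz_on UNIV g)"
proof -
  have lip: "(\<forall>x y. \<bar>g x - g y\<bar> \<le> C1 * dist x y) \<longleftrightarrow> C1-lipschitz_on UNIV g" for g :: "'a \<Rightarrow> real"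
    by (simp add: lipschitz_on_UNIV_iff dist_real_def)
  show ?thesis
    unfolding dens_class_def mem_Collect_eq lip
    by (rule conj_cong[OF refl], rule iff_exI) (auto intro: lipschitz_on_borel_measurable)
qed

lemma dens_class_prob: "\<pi> \<in> dens_class C C1 \<Longrightarrow> \<pi> \<in> space (prob_algebra borel)"
  by (auto simp: dens_class_def space_prob_algebra)

lemma weak_conv_imp_tv_conv:
  assumes \<pi>: "\<pi> \<in> dens_class C C1" and \<pi>s: "\<And>n. \<pi>s n \<in> dens_class C C1"
    and weak: "weak_conv_seq \<pi>s \<pi>"
  shows "tv_conv \<pi>s \<pi>"
proof -
  obtain g where g: "\<pi> = real_density g" "\<And>x. 0 \<le> g x" "C1-lipschitz_on UNIV g"
    using \<pi> unfolding dens_class_iff by blast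
  have "\<forall>n. \<exists>h. \<pi>s n = real_density h \<and> (\<forall>x. 0 \<le> h x) \<and> C1-lipschitz_on UNIV h"
    using \<pi>s unfolding dens_class_iff by blast
  then obtain gs where gs: "\<And>n. \<pi>s n = real_density (gs n)"
    "\<And>n x. 0 \<le> gs n x" "\<And>n. C1-lipschitz_on UNIV (gs n)"
    by metis
  have "weak_conv_seq (\<lambda>n. real_density (gs n)) (real_density g)"
    using weak by (simp flip: g(1) gs(1))
  then have "(\<lambda>n. gs n x) \<longlonglongrightarrow> g x" for x
    by (rule weak_conv_lipschitz_densities_pointwise[OF _ gs(3,2) g(3,2)])
  moreover have "prob_space (real_density (gs n))" "prob_space (real_density g)" for n
    using \<pi> \<pi>s[of n] unfolding dens_class_iff by (simp_all flip: g(1) gs(1))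
  ultimately have "tv_conv (\<lambda>n. real_density (gs n)) (real_density g)"
    using g gs by (intro tv_conv_densities lipschitz_on_borel_measurable) auto
  then show ?thesis by (simp flip: g(1) gs(1))
qed

lemma lipschitz_kernel_density_measurable:
  fixes \<kappa> :: "'b \<Rightarrow> 'a::euclidean_space measure"
  assumes \<kappa>: "\<kappa> \<in> N \<rightarrow>\<^sub>M subprob_algebra borel" "\<And>x. \<kappa> x = real_density (\<phi> x)"
    and \<phi>: "\<And>x. L-lipschitz_on UNIV (\<phi> x)" "\<And>x z. 0 \<le> \<phi> x z"
  shows "(\<lambda>(x, z). \<phi> x z) \<in> borel_measurable (N \<Otimes>\<^sub>M borel)"
proof (rule borel_measurable_LIMSEQ_real)
  let ?m = "\<lambda>k (x, z). tent_mean (inverse (real (Suc k))) (\<kappa> x) z"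
  show "?m k \<in> borel_measurable (N \<Otimes>\<^sub>M borel)" for k
  proof -
    let ?t = "tent (inverse (real (Suc k)))"
    have "(\<lambda>p. \<kappa> (fst p)) \<in> N \<Otimes>\<^sub>M borel \<rightarrow>\<^sub>M subprob_algebra borel"
      by (rule measurable_compose[OF measurable_fst \<kappa>(1)])
    then have [measurable]: "(\<lambda>p. \<integral>\<^sup>+y. ennreal (?t (snd p) y) \<partial>\<kappa> (fst p))
        \<in> borel_measurable (N \<Otimes>\<^sub>M borel)"
      by (intro nn_integral_measurable_subprob_algebra2[where N = borel]) measurable
    have integral_eq: "(\<integral>y. ?t z y \<partial>\<kappa> x) = enn2real (\<integral>\<^sup>+y. ennreal (?t z y) \<partial>\<kappa> x)" for x z
      unfolding \<kappa>(2) by (intro integral_eq_nn_integral) (auto simp: tent_nonneg)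
    show ?thesis unfolding tent_mean_def case_prod_beta integral_eq by measurable
  qed
  show "(\<lambda>k. ?m k p) \<longlonglongrightarrow> (case p of (x, z) \<Rightarrow> \<phi> x z)" for p
    using tendsto_uniform_limitI[OF uniform_limit_tent_mean[of UNIV L \<phi> "snd p"], of "fst p"] \<phi>
    by (simp add: \<kappa>(2) case_prod_beta)
qed

section \<open>Joint convergence of measures and quantizers\<close>

definition admissible :: "'a::topological_space measure \<Rightarrow> ('a \<Rightarrow> nat) \<Rightarrow> bool" where
  "admissible \<pi> Q \<longleftrightarrow> \<pi> \<in> space (prob_algebra borel) \<and> Q \<in> borel_measurable borel"

definition admissible_conv ::
  "(nat \<Rightarrow> 'a::topological_space measure) \<Rightarrow> (nat \<Rightarrow> 'a \<Rightarrow> nat) \<Rightarrow> 'a measure \<Rightarrow> ('a \<Rightarrow> nat) \<Rightarrow> bool" where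
  "admissible_conv \<pi>s Qs \<pi> Q \<longleftrightarrow> (\<forall>n. admissible (\<pi>s n) (Qs n)) \<and> admissible \<pi> Q \<and>
     tv_conv \<pi>s \<pi> \<and> stabilizes_on UNIV Qs Q"

lemma admissible_conv_subseq:
  assumes "admissible_conv \<pi>s Qs \<pi> Q" "strict_mono r"
  shows "admissible_conv (\<lambda>n. \<pi>s (r n)) (\<lambda>n. Qs (r n)) \<pi> Q"
  using assms by (simp add: admissible_conv_def tv_conv_subseq stabilizes_on_subseq)

lemma admissible_conv_const_measure:
  assumes "admissible_conv \<pi>s Qs \<pi> Q"
  shows "admissible_conv (\<lambda>_. \<pi>) Qs \<pi> Q"
  using assms by (simp add: admissible_conv_def admissible_def tv_conv_const)

lemma quantizers_c_admissible:
  "\<pi> \<in> space (prob_algebra borel) \<Longrightarrow> Q \<in> quantizers_c M \<Longrightarrow> admissible \<pi> Q"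
  by (simp add: admissible_def quantizers_c_def)

lemma admissible_conv_subsequence:
  fixes \<pi>s :: "nat \<Rightarrow> 'a::euclidean_space measure"
  assumes "\<pi> \<in> space (prob_algebra borel)" "\<And>n. \<pi>s n \<in> space (prob_algebra borel)" "tv_conv \<pi>s \<pi>"
    and Qs: "\<And>n. Qs n \<in> quantizers_c M"
  obtains r Q where "strict_mono r" "Q \<in> quantizers_c M"
    "admissible_conv (\<lambda>n. \<pi>s (r n)) (\<lambda>n. Qs (r n)) \<pi> Q"
proof -
  obtain r Q where r: "strict_mono r" and Q: "Q \<in> quantizers_c M"
    and "stabilizes_on UNIV (\<lambda>n. Qs (r n)) Q"
    by (rule quantizers_c_convergent_subsequence[OF Qs])
  then have "admissible_conv (\<lambda>n. \<pi>s (r n)) (\<lambda>n. Qs (r n)) \<pi> Q"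
    unfolding admissible_conv_def using assms quantizers_c_admissible[OF _ Q]
    by (simp add: quantizers_c_admissible[OF _ Qs] tv_conv_subseq)
  then show thesis using that r Q by blast
qed

lemma indicator_cell_bounded_borel:
  assumes "admissible \<pi> Q"
  shows "indicator (Q -` {i}) \<in> bounded_borel 1"
proof -
  have [measurable]: "Q -` {i} \<in> sets borel" using assms by (simp add: admissible_def cell_borel)
  show ?thesis by (auto simp: bounded_borel_def indicator_def)
qed

lemma abs_cell_integral_le:
  assumes "admissible \<pi> Q" "h \<in> bounded_borel B"
  shows "\<bar>\<integral>x. indicator (Q -` {i}) x * h x \<partial>\<pi>\<bar> \<le> B"
proof (rule abs_integral_bounded_borel)
  show "\<pi> \<in> space (prob_algebra borel)" using assms(1) by (simp add: admissible_def)
  show "(\<lambda>x. indicator (Q -` {i}) x * h x) \<in> bounded_borel B"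
    using bounded_borel_mult[OF indicator_cell_bounded_borel[OF assms(1)] assms(2)] by simp
qed

lemma cell_measure_eq_integral:
  assumes "admissible \<pi> Q"
  shows "measure \<pi> (Q -` {i}) = (\<integral>x. indicator (Q -` {i}) x * 1 \<partial>\<pi>)"
proof -
  have "sets \<pi> = sets borel" using assms by (simp add: admissible_def space_prob_algebra)
  then have "space \<pi> = UNIV" using sets_eq_imp_space_eq[of \<pi> borel] by simp
  then show ?thesis by simp
qed

lemma uniform_limit_cell_integral:
  assumes "admissible_conv \<pi>s Qs \<pi> Q"
  shows "uniform_limit (bounded_borel B) (\<lambda>n h. \<integral>x. indicator (Qs n -` {i}) x * h x \<partial>\<pi>s n)
    (\<lambda>h. \<integral>x. indicator (Q -` {i}) x * h x \<partial>\<pi>) sequentially"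
proof (rule uniform_limit_weighted_integral)
  show "tv_conv \<pi>s \<pi>" using assms by (simp add: admissible_conv_def)
  show "finite_measure \<pi>" "sets \<pi> = sets borel"
    using assms by (auto simp: admissible_conv_def admissible_def space_prob_algebra prob_space_def)
  show "indicator (Qs n -` {i}) \<in> bounded_borel 1" for n
    using assms indicator_cell_bounded_borel by (auto simp: admissible_conv_def)
  show "(\<lambda>n. indicator (Qs n -` {i}) x :: real) \<longlonglongrightarrow> indicator (Q -` {i}) x" for x
  proof (rule tendsto_eventually)
    have "\<forall>\<^sub>F n in sequentially. Qs n x = Q x"
      using assms by (simp add: admissible_conv_def stabilizes_on_def)
    then show "\<forall>\<^sub>F n in sequentially. indicator (Qs n -` {i}) x = (indicator (Q -` {i}) x :: real)"
      by eventually_elim (simp add: indicator_def)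
  qed
qed

lemma cell_measure_tendsto:
  assumes "admissible_conv \<pi>s Qs \<pi> Q"
  shows "(\<lambda>n. measure (\<pi>s n) (Qs n -` {i})) \<longlonglongrightarrow> measure \<pi> (Q -` {i})"
proof -
  have "(\<lambda>_. 1) \<in> bounded_borel 1" by (simp add: bounded_borel_def)
  then have "(\<lambda>n. \<integral>x. indicator (Qs n -` {i}) x * (1 :: real) \<partial>\<pi>s n)
      \<longlonglongrightarrow> (\<integral>x. indicator (Q -` {i}) x * 1 \<partial>\<pi>)"
    by (rule tendsto_uniform_limitI[OF uniform_limit_cell_integral[OF assms]])
  moreover have "admissible \<pi> Q" "\<And>n. admissible (\<pi>s n) (Qs n)"
    using assms by (simp_all add: admissible_conv_def)
  ultimately show ?thesis by (simp only: cell_measure_eq_integral)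
qed

section \<open>Filter updates as mixtures of the kernel\<close>

lemma integral_uniform_measure:
  fixes h :: "'a \<Rightarrow> real"
  assumes "finite_measure M" and [measurable]: "A \<in> sets M" "h \<in> borel_measurable M"
    and nz: "measure M A \<noteq> 0"
  shows "(\<integral>x. h x \<partial>uniform_measure M A) = (\<integral>x. indicator A x * h x \<partial>M) / measure M A"
proof -
  interpret finite_measure M by fact
  have "0 < measure M A" using nz by (simp add: zero_less_measure_iff)
  then have "indicator A x / emeasure M A = ennreal (indicator A x / measure M A)" for x
    by (cases "x \<in> A") (simp_all add: emeasure_eq_measure flip: divide_ennreal)
  then have "(\<integral>x. h x \<partial>uniform_measure M A) = (\<integral>x. indicator A x / measure M A * h x \<partial>M)"
    unfolding uniform_measure_def by (simp add: integral_density)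
  then show ?thesis by simp
qed

locale lipschitz_kernel =
  fixes \<phi> :: "'a::euclidean_space \<Rightarrow> 'a \<Rightarrow> real" and C C1 :: real
  assumes \<phi>_measurable [measurable]: "(\<lambda>(x, z). \<phi> x z) \<in> borel_measurable (borel \<Otimes>\<^sub>M borel)"
    and \<phi>_prob: "\<And>x. prob_space (real_density (\<phi> x))"
    and \<phi>_nonneg: "\<And>x z. 0 \<le> \<phi> x z"
    and \<phi>_le: "\<And>x z. \<phi> x z \<le> C"
    and \<phi>_lipschitz: "\<And>x. C1-lipschitz_on UNIV (\<phi> x)"
begin

definition mixture_density :: "'a measure \<Rightarrow> 'a \<Rightarrow> real" where
  "mixture_density \<nu> z = (\<integral>x. \<phi> x z \<partial>\<nu>)"

lemma kernel_section_bounded_borel: "(\<lambda>x. \<phi> x z) \<in> bounded_borel C"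
  using \<phi>_nonneg \<phi>_le by (simp add: bounded_borel_def)

lemma mixture_density_nonneg: "0 \<le> mixture_density \<nu> z"
  unfolding mixture_density_def by (intro integral_nonneg_AE AE_I2 \<phi>_nonneg)

lemma mixture_density_le:
  assumes "\<nu> \<in> space (prob_algebra borel)"
  shows "mixture_density \<nu> z \<le> C"
  using abs_integral_bounded_borel[OF assms kernel_section_bounded_borel[of z]]
  by (simp add: mixture_density_def)

lemma mixture_density_lipschitz:
  assumes \<nu>: "\<nu> \<in> space (prob_algebra borel)"
  shows "C1-lipschitz_on UNIV (mixture_density \<nu>)"
proof (rule lipschitz_onI)
  fix z z'
  have "(\<lambda>x. \<phi> x z - \<phi> x z') \<in> bounded_borel (C1 * dist z z')"
    using lipschitz_onD[OF \<phi>_lipschitz, of z z'] by (simp add: bounded_borel_def dist_real_def)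
  then have "\<bar>\<integral>x. \<phi> x z - \<phi> x z' \<partial>\<nu>\<bar> \<le> C1 * dist z z'"
    by (rule abs_integral_bounded_borel[OF \<nu>])
  then show "dist (mixture_density \<nu> z) (mixture_density \<nu> z') \<le> C1 * dist z z'"
    using integrable_bounded_borel[OF \<nu> kernel_section_bounded_borel]
    by (simp add: mixture_density_def dist_real_def)
qed (rule lipschitz_on_nonneg[OF \<phi>_lipschitz])

lemma nn_integral_mixture_density:
  assumes \<nu>: "\<nu> \<in> space (prob_algebra borel)"
  shows "(\<integral>\<^sup>+z. ennreal (mixture_density \<nu> z) \<partial>lborel) = 1"
proof -
  interpret prob_space \<nu> using \<nu> by (simp add: space_prob_algebra)
  interpret pair_sigma_finite lborel \<nu> ..
  have [measurable_cong]: "sets \<nu> = sets borel" using \<nu> by (simp add: space_prob_algebra)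
  have kernel_mass: "(\<integral>\<^sup>+z. ennreal (\<phi> x z) \<partial>lborel) = 1" for x
    using integrable_nonneg_density(2)[OF _ \<phi>_nonneg \<phi>_prob[of x]]
      lipschitz_on_borel_measurable[OF \<phi>_lipschitz[of x]] by simp
  have "(\<integral>\<^sup>+z. ennreal (mixture_density \<nu> z) \<partial>lborel) = (\<integral>\<^sup>+z. (\<integral>\<^sup>+x. ennreal (\<phi> x z) \<partial>\<nu>) \<partial>lborel)"
    unfolding mixture_density_def
    using integrable_bounded_borel[OF \<nu> kernel_section_bounded_borel] \<phi>_nonneg
    by (intro nn_integral_cong nn_integral_eq_integral[symmetric]) auto
  also have "\<dots> = (\<integral>\<^sup>+x. (\<integral>\<^sup>+z. ennreal (\<phi> x z) \<partial>lborel) \<partial>\<nu>)"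
    by (rule Fubini'[symmetric]) measurable
  also have "\<dots> = 1" by (simp add: kernel_mass emeasure_space_1)
  finally show ?thesis .
qed

lemma mixture_in_dens_class:
  assumes "\<nu> \<in> space (prob_algebra borel)"
  shows "real_density (mixture_density \<nu>) \<in> dens_class C C1"
proof -
  note lip = mixture_density_lipschitz[OF assms]
  have "prob_space (real_density (mixture_density \<nu>))"
    using lipschitz_on_borel_measurable[OF lip] nn_integral_mixture_density[OF assms]
    by (intro prob_spaceI) (simp add: emeasure_density)
  then show ?thesis
    unfolding dens_class_iff using mixture_density_nonneg mixture_density_le[OF assms] lip by blast
qed

lemma mixture_density_uniform_measure:
  assumes adm: "admissible \<pi> Q" and nz: "measure \<pi> (Q -` {m}) \<noteq> 0"
  shows "mixture_density (uniform_measure \<pi> (Q -` {m})) z =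
    (\<integral>x. indicator (Q -` {m}) x * \<phi> x z \<partial>\<pi>) / measure \<pi> (Q -` {m})"
proof -
  have sets_\<pi>: "sets \<pi> = sets borel" and fin: "finite_measure \<pi>"
    using adm by (auto simp: admissible_def space_prob_algebra prob_space_def)
  have "Q -` {m} \<in> sets \<pi>" using adm by (simp add: sets_\<pi> admissible_def cell_borel)
  moreover have "(\<lambda>x. \<phi> x z) \<in> borel_measurable \<pi>"
    by (simp add: measurable_cong_sets[OF sets_\<pi> refl])
  ultimately show ?thesis
    unfolding mixture_density_def by (rule integral_uniform_measure[OF fin _ _ nz])
qed

lemma filter_update_eq_mixture:
  assumes "admissible \<pi> Q" "measure \<pi> (Q -` {m}) \<noteq> 0"
  shows "filter_update \<phi> m \<pi> Q = real_density (mixture_density (uniform_measure \<pi> (Q -` {m})))"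
  by (simp add: filter_update_def mixture_density_uniform_measure[OF assms])

lemma uniform_measure_cell_prob:
  assumes adm: "admissible \<pi> Q" and nz: "measure \<pi> (Q -` {m}) \<noteq> 0"
  shows "uniform_measure \<pi> (Q -` {m}) \<in> space (prob_algebra borel)"
proof -
  interpret prob_space \<pi> using adm by (simp add: admissible_def space_prob_algebra)
  have "prob_space (uniform_measure \<pi> (Q -` {m}))"
    using nz by (intro prob_space_uniform_measure) (auto simp: emeasure_eq_measure)
  then show ?thesis
    using adm by (simp add: admissible_def space_prob_algebra)
qed

lemma filter_update_in_dens_class:
  assumes "admissible \<pi> Q" "measure \<pi> (Q -` {m}) \<noteq> 0"
  shows "filter_update \<phi> m \<pi> Q \<in> dens_class C C1"
  unfolding filter_update_eq_mixture[OF assms]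
  by (rule mixture_in_dens_class[OF uniform_measure_cell_prob[OF assms]])

lemma filter_update_tv_conv:
  assumes conv: "admissible_conv \<pi>s Qs \<pi> Q"
    and nz: "measure \<pi> (Q -` {m}) \<noteq> 0" "\<And>n. measure (\<pi>s n) (Qs n -` {m}) \<noteq> 0"
  shows "tv_conv (\<lambda>n. filter_update \<phi> m (\<pi>s n) (Qs n)) (filter_update \<phi> m \<pi> Q)"
proof -
  have adm: "admissible \<pi> Q" "\<And>n. admissible (\<pi>s n) (Qs n)"
    using conv by (simp_all add: admissible_conv_def)
  note cond_prob = uniform_measure_cell_prob[OF adm(1) nz(1)]
    uniform_measure_cell_prob[OF adm(2) nz(2)]
  have "(\<lambda>n. \<integral>x. indicator (Qs n -` {m}) x * \<phi> x z \<partial>\<pi>s n)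
      \<longlonglongrightarrow> (\<integral>x. indicator (Q -` {m}) x * \<phi> x z \<partial>\<pi>)" for z
    using kernel_section_bounded_borel
    by (rule tendsto_uniform_limitI[OF uniform_limit_cell_integral[OF conv]])
  then have lim: "(\<lambda>n. mixture_density (uniform_measure (\<pi>s n) (Qs n -` {m})) z)
      \<longlonglongrightarrow> mixture_density (uniform_measure \<pi> (Q -` {m})) z" for z
    unfolding mixture_density_uniform_measure[OF adm(1) nz(1)]
      mixture_density_uniform_measure[OF adm(2) nz(2)]
    by (rule tendsto_divide[OF _ cell_measure_tendsto[OF conv] nz(1)])
  show ?thesis
    unfolding filter_update_eq_mixture[OF adm(1) nz(1)] filter_update_eq_mixture[OF adm(2) nz(2)]
  proof (rule tv_conv_densities)
    show "mixture_density (uniform_measure \<pi> (Q -` {m})) \<in> borel_measurable borel"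
      "mixture_density (uniform_measure (\<pi>s n) (Qs n -` {m})) \<in> borel_measurable borel" for n
      by (rule lipschitz_on_borel_measurable[OF mixture_density_lipschitz], rule cond_prob)+
    show "prob_space (real_density (mixture_density (uniform_measure \<pi> (Q -` {m}))))"
      "prob_space (real_density (mixture_density (uniform_measure (\<pi>s n) (Qs n -` {m}))))" for n
      using mixture_in_dens_class[OF cond_prob(1)] mixture_in_dens_class[OF cond_prob(2)]
      by (auto simp: dens_class_iff)
  qed (rule mixture_density_nonneg lim)+
qed

end

section \<open>Dynamic programming\<close>

lemma abs_INF_diff_le:
  fixes f g :: "'a \<Rightarrow> real"
  assumes "A \<noteq> {}" "bdd_below (f ` A)" "bdd_below (g ` A)" "\<And>x. x \<in> A \<Longrightarrow> \<bar>f x - g x\<bar> \<le> e"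
  shows "\<bar>(INF x\<in>A. f x) - (INF x\<in>A. g x)\<bar> \<le> e"
proof -
  have INF_le: "(INF x\<in>A. p x) - e \<le> (INF x\<in>A. q x)"
    if "bdd_below (p ` A)" "\<And>x. x \<in> A \<Longrightarrow> p x - q x \<le> e" for p q :: "'a \<Rightarrow> real"
  proof (rule cINF_greatest[OF assms(1)])
    fix x assume x: "x \<in> A"
    show "(INF x\<in>A. p x) - e \<le> q x"
      using cINF_lower[OF that(1) x] that(2)[OF x] by linarith
  qed
  have "f x - g x \<le> e" "g x - f x \<le> e" if "x \<in> A" for x
    using assms(4)[OF that] by linarith+
  then show ?thesis
    using INF_le[OF assms(2), of g] INF_le[OF assms(3), of f] by force
qed

lemma tendsto_INF_uniform_limit:
  fixes f :: "'n \<Rightarrow> 'a \<Rightarrow> real"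
  assumes "uniform_limit A f g F" "A \<noteq> {}" "\<And>n. bdd_below (f n ` A)" "bdd_below (g ` A)"
  shows "((\<lambda>n. INF x\<in>A. f n x) \<longlongrightarrow> (INF x\<in>A. g x)) F"
proof (rule tendstoI)
  fix e :: real assume "0 < e"
  then have "\<forall>\<^sub>F n in F. \<forall>x\<in>A. dist (f n x) (g x) < e / 2"
    by (intro uniform_limitD[OF assms(1)]) simp
  then show "\<forall>\<^sub>F n in F. dist (INF x\<in>A. f n x) (INF x\<in>A. g x) < e"
  proof eventually_elim
    case (elim n)
    then have "\<bar>(INF x\<in>A. f n x) - (INF x\<in>A. g x)\<bar> \<le> e / 2"
      by (intro abs_INF_diff_le assms(2-4)) (auto simp: dist_real_def intro: less_imp_le)
    then show ?case using \<open>0 < e\<close> by (simp add: dist_real_def)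
  qed
qed

lemma uniform_limit_subsequenceI:
  fixes f :: "nat \<Rightarrow> 'a \<Rightarrow> 'b::metric_space"
  assumes "\<And>(s :: nat \<Rightarrow> nat) xs. strict_mono s \<Longrightarrow> (\<And>n. xs n \<in> A) \<Longrightarrow>
    \<exists>r. strict_mono r \<and> (\<lambda>n. dist (f (s (r n)) (xs (r n))) (g (xs (r n)))) \<longlonglongrightarrow> 0"
  shows "uniform_limit A f g sequentially"
proof (rule ccontr)
  assume "\<not> ?thesis"
  then obtain e where "0 < e" and "\<not> (\<forall>\<^sub>F n in sequentially. \<forall>x\<in>A. dist (f n x) (g x) < e)"
    unfolding uniform_limit_iff by blast
  then obtain s :: "nat \<Rightarrow> nat" where s: "strict_mono s" "\<And>n. \<exists>x\<in>A. \<not> dist (f (s n) x) (g x) < e"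
    using not_eventually_sequentiallyD by blast
  then obtain xs where xs: "\<And>n. xs n \<in> A" "\<And>n. \<not> dist (f (s n) (xs n)) (g (xs n)) < e"
    by metis
  obtain r where "(\<lambda>n. dist (f (s (r n)) (xs (r n))) (g (xs (r n)))) \<longlonglongrightarrow> 0"
    using assms[OF s(1), of xs] xs(1) by blast
  then have "\<forall>\<^sub>F n in sequentially. dist (f (s (r n)) (xs (r n))) (g (xs (r n))) < e"
    using \<open>0 < e\<close> by (rule order_tendstoD)
  then show False using xs(2) by simp
qed

definition tv_continuous_on ::
  "'a::topological_space measure set \<Rightarrow> ('a measure \<Rightarrow> real) \<Rightarrow> bool" where
  "tv_continuous_on S J \<longleftrightarrow> (\<forall>\<mu>s. \<forall>\<mu>\<in>S. (\<forall>n. \<mu>s n \<in> S) \<longrightarrow> tv_conv \<mu>s \<mu> \<longrightarrow> (\<lambda>n. J (\<mu>s n)) \<longlonglongrightarrow> J \<mu>)"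

lemma tv_continuous_onD:
  assumes "tv_continuous_on S J" "\<mu> \<in> S" "\<And>n. \<mu>s n \<in> S" "tv_conv \<mu>s \<mu>"
  shows "(\<lambda>n. J (\<mu>s n)) \<longlonglongrightarrow> J \<mu>"
  using assms unfolding tv_continuous_on_def by blast

locale quantized_control = lipschitz_kernel \<phi> C C1
  for \<phi> :: "'a::euclidean_space \<Rightarrow> 'a \<Rightarrow> real" and C C1 +
  fixes c0 :: "'a \<Rightarrow> 'u \<Rightarrow> real" and U :: "'u set" and K :: real and M T :: nat
  assumes c0_bounded_borel: "\<And>u. u \<in> U \<Longrightarrow> (\<lambda>x. c0 x u) \<in> bounded_borel K"
    and U_nonempty: "U \<noteq> {}"
    and M_pos: "1 \<le> M"
begin

abbreviation objective :: "('a measure \<Rightarrow> real) \<Rightarrow> 'a measure \<Rightarrow> ('a \<Rightarrow> nat) \<Rightarrow> real" where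
  "objective \<equiv> stage_obj M c0 U \<phi> T"

lemma bdd_below_cell_cost:
  assumes "admissible \<pi> Q"
  shows "bdd_below ((\<lambda>u. \<integral>x. indicator (Q -` {i}) x * c0 x u \<partial>\<pi>) ` U)"
proof (rule bdd_belowI2)
  fix u assume "u \<in> U"
  then show "- K \<le> (\<integral>x. indicator (Q -` {i}) x * c0 x u \<partial>\<pi>)"
    using abs_cell_integral_le[OF assms c0_bounded_borel, of u i] by linarith
qed

lemma abs_qcost_le:
  assumes "admissible \<pi> Q"
  shows "\<bar>qcost M c0 U \<pi> Q\<bar> \<le> real M * K"
proof -
  have "\<bar>INF u\<in>U. \<integral>x. indicator (Q -` {i}) x * c0 x u \<partial>\<pi>\<bar> \<le> K" for i
  proof (rule cInf_abs_ge)
    show "\<bar>y\<bar> \<le> K" if "y \<in> (\<lambda>u. \<integral>x. indicator (Q -` {i}) x * c0 x u \<partial>\<pi>) ` U" for y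
      using that abs_cell_integral_le[OF assms c0_bounded_borel] by blast
  qed (use U_nonempty in simp)
  then have "norm (qcost M c0 U \<pi> Q) \<le> of_nat (card {1..M}) * K"
    unfolding qcost_def by (intro sum_norm_bound) simp
  then show ?thesis by simp
qed

lemma qcost_tendsto:
  assumes conv: "admissible_conv \<pi>s Qs \<pi> Q"
  shows "(\<lambda>n. qcost M c0 U (\<pi>s n) (Qs n)) \<longlonglongrightarrow> qcost M c0 U \<pi> Q"
  unfolding qcost_def
proof (intro tendsto_sum tendsto_INF_uniform_limit U_nonempty bdd_below_cell_cost)
  show "uniform_limit U (\<lambda>n u. \<integral>x. indicator (Qs n -` {i}) x * c0 x u \<partial>\<pi>s n)
      (\<lambda>u. \<integral>x. indicator (Q -` {i}) x * c0 x u \<partial>\<pi>) sequentially" for i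
    using c0_bounded_borel
    by (intro uniform_limit_compose'[OF uniform_limit_cell_integral[OF conv]]) blast
qed (use conv in \<open>auto simp: admissible_conv_def\<close>)

definition cell_value :: "('a measure \<Rightarrow> real) \<Rightarrow> 'a measure \<Rightarrow> ('a \<Rightarrow> nat) \<Rightarrow> nat \<Rightarrow> real" where
  "cell_value J \<pi> Q m = (if measure \<pi> (Q -` {m}) = 0 then 0
     else J (filter_update \<phi> m \<pi> Q) * measure \<pi> (Q -` {m}))"

lemma objective_eq_cell_value:
  "objective J \<pi> Q = (1 / real T) * qcost M c0 U \<pi> Q + (\<Sum>m=1..M. cell_value J \<pi> Q m)"
  by (simp add: stage_obj_def cell_value_def)

definition bounded_tv_continuous :: "('a measure \<Rightarrow> real) \<Rightarrow> bool" where
  "bounded_tv_continuous J \<longleftrightarrow> bounded (J ` dens_class C C1) \<and> tv_continuous_on (dens_class C C1) J"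

lemma bounded_tv_continuous_bound:
  assumes "bounded_tv_continuous J"
  obtains B where "0 < B" "\<And>\<mu>. \<mu> \<in> dens_class C C1 \<Longrightarrow> \<bar>J \<mu>\<bar> \<le> B"
  using assms unfolding bounded_tv_continuous_def bounded_pos by auto

lemma abs_cell_value_le:
  assumes "admissible \<pi> Q" "0 \<le> B" "\<And>\<mu>. \<mu> \<in> dens_class C C1 \<Longrightarrow> \<bar>J \<mu>\<bar> \<le> B"
  shows "\<bar>cell_value J \<pi> Q m\<bar> \<le> B * measure \<pi> (Q -` {m})"
proof (cases "measure \<pi> (Q -` {m}) = 0")
  case False
  then show ?thesis
    using assms(3)[OF filter_update_in_dens_class[OF assms(1) False]]
    by (simp add: cell_value_def abs_mult mult_right_mono)
qed (simp add: cell_value_def)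

lemma abs_objective_le:
  assumes adm: "admissible \<pi> Q" and B: "0 \<le> B" "\<And>\<mu>. \<mu> \<in> dens_class C C1 \<Longrightarrow> \<bar>J \<mu>\<bar> \<le> B"
  shows "\<bar>objective J \<pi> Q\<bar> \<le> (1 / real T) * (real M * K) + real M * B"
proof -
  interpret prob_space \<pi> using adm by (simp add: admissible_def space_prob_algebra)
  have "\<bar>cell_value J \<pi> Q m\<bar> \<le> B" for m
    by (rule order_trans[OF abs_cell_value_le[OF adm B] mult_left_le[OF prob_le_1 B(1)]])
  then have "\<bar>\<Sum>m=1..M. cell_value J \<pi> Q m\<bar> \<le> real M * B"
    using sum_norm_bound[of "{1..M}" "cell_value J \<pi> Q" B] by simp
  moreover have "\<bar>(1 / real T) * qcost M c0 U \<pi> Q\<bar> \<le> (1 / real T) * (real M * K)"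
    unfolding abs_mult using abs_qcost_le[OF adm] by (intro mult_mono) auto
  ultimately show ?thesis
    unfolding objective_eq_cell_value by linarith
qed

lemma cell_value_tendsto:
  assumes J: "bounded_tv_continuous J" and conv: "admissible_conv \<pi>s Qs \<pi> Q"
  shows "(\<lambda>n. cell_value J (\<pi>s n) (Qs n) m) \<longlonglongrightarrow> cell_value J \<pi> Q m"
proof (cases "measure \<pi> (Q -` {m}) = 0")
  case True
  obtain B where B: "0 < B" "\<And>\<mu>. \<mu> \<in> dens_class C C1 \<Longrightarrow> \<bar>J \<mu>\<bar> \<le> B"
    using bounded_tv_continuous_bound[OF J] by blast
  have "norm (cell_value J (\<pi>s n) (Qs n) m) \<le> B * measure (\<pi>s n) (Qs n -` {m})" for n
    using abs_cell_value_le[of "\<pi>s n" "Qs n" B J] conv B by (simp add: admissible_conv_def)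
  moreover have "(\<lambda>n. B * measure (\<pi>s n) (Qs n -` {m})) \<longlonglongrightarrow> 0"
    using cell_measure_tendsto[OF conv, of m] True by (intro tendsto_mult_right_zero) simp
  ultimately have "(\<lambda>n. cell_value J (\<pi>s n) (Qs n) m) \<longlonglongrightarrow> 0"
    by (rule Lim_null_comparison[OF always_eventually[OF allI]])
  then show ?thesis using True by (simp add: cell_value_def)
next
  case False
  have "\<forall>\<^sub>F n in sequentially. measure (\<pi>s n) (Qs n -` {m}) \<noteq> 0"
    by (rule tendsto_imp_eventually_ne[OF cell_measure_tendsto[OF conv] False])
  then obtain N where "\<And>n. n \<ge> N \<Longrightarrow> measure (\<pi>s n) (Qs n -` {m}) \<noteq> 0"
    unfolding eventually_sequentially by blast
  then have nz: "measure (\<pi>s (n + N)) (Qs (n + N) -` {m}) \<noteq> 0" for n by simp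
  have tail: "admissible_conv (\<lambda>n. \<pi>s (n + N)) (\<lambda>n. Qs (n + N)) \<pi> Q"
    by (rule admissible_conv_subseq[OF conv]) (simp add: strict_mono_def)
  then have adm: "admissible \<pi> Q" "\<And>n. admissible (\<pi>s (n + N)) (Qs (n + N))"
    by (simp_all add: admissible_conv_def)
  have "(\<lambda>n. J (filter_update \<phi> m (\<pi>s (n + N)) (Qs (n + N)))) \<longlonglongrightarrow> J (filter_update \<phi> m \<pi> Q)"
  proof (rule tv_continuous_onD)
    show "tv_continuous_on (dens_class C C1) J" using J by (simp add: bounded_tv_continuous_def)
  qed (rule filter_update_in_dens_class adm False nz filter_update_tv_conv[OF tail])+
  then have "(\<lambda>n. cell_value J (\<pi>s (n + N)) (Qs (n + N)) m) \<longlonglongrightarrow> cell_value J \<pi> Q m"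
    using nz False cell_measure_tendsto[OF tail, of m] by (simp add: cell_value_def tendsto_mult)
  then show ?thesis by (rule LIMSEQ_offset)
qed

lemma objective_tendsto:
  assumes "bounded_tv_continuous J" "admissible_conv \<pi>s Qs \<pi> Q"
  shows "(\<lambda>n. objective J (\<pi>s n) (Qs n)) \<longlonglongrightarrow> objective J \<pi> Q"
  unfolding objective_eq_cell_value
  by (intro tendsto_add tendsto_mult tendsto_const tendsto_sum
      qcost_tendsto cell_value_tendsto assms)

lemma compact_objective_quantizers_c:
  assumes J: "bounded_tv_continuous J" and \<pi>: "\<pi> \<in> space (prob_algebra borel)"
  shows "compact (objective J \<pi> ` quantizers_c M)"
  unfolding compact_def
proof (intro allI impI)
  fix f :: "nat \<Rightarrow> real" assume "\<forall>n. f n \<in> objective J \<pi> ` quantizers_c M"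
  then obtain Qs :: "nat \<Rightarrow> 'a \<Rightarrow> nat"
    where Qs: "\<And>n. Qs n \<in> quantizers_c M" and f: "\<And>n. f n = objective J \<pi> (Qs n)"
    unfolding image_iff by metis
  obtain r Q where "strict_mono r" "Q \<in> quantizers_c M" "admissible_conv (\<lambda>_. \<pi>) (\<lambda>n. Qs (r n)) \<pi> Q"
    by (rule admissible_conv_subsequence[OF \<pi> \<pi> tv_conv_const Qs])
  then show "\<exists>l\<in>objective J \<pi> ` quantizers_c M. \<exists>r. strict_mono r \<and> (f \<circ> r) \<longlonglongrightarrow> l"
    using objective_tendsto[OF J] unfolding comp_def f by blast
qed

lemma uniform_limit_objective:
  assumes J: "bounded_tv_continuous J" and \<pi>: "\<pi> \<in> space (prob_algebra borel)"
    and \<pi>s: "\<And>n. \<pi>s n \<in> space (prob_algebra borel)" and tv: "tv_conv \<pi>s \<pi>"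
  shows "uniform_limit (quantizers_c M) (\<lambda>n. objective J (\<pi>s n)) (objective J \<pi>) sequentially"
proof (rule uniform_limit_subsequenceI)
  fix s :: "nat \<Rightarrow> nat" and Qs :: "nat \<Rightarrow> 'a \<Rightarrow> nat"
  assume "strict_mono s" and Qs: "\<And>n. Qs n \<in> quantizers_c M"
  then have "tv_conv (\<lambda>n. \<pi>s (s n)) \<pi>" by (intro tv_conv_subseq[OF tv])
  then obtain r Q where r: "strict_mono r"
    and conv: "admissible_conv (\<lambda>n. \<pi>s (s (r n))) (\<lambda>n. Qs (r n)) \<pi> Q"
    by (rule admissible_conv_subsequence[OF \<pi> \<pi>s _ Qs])
  have "(\<lambda>n. dist (objective J (\<pi>s (s (r n))) (Qs (r n))) (objective J \<pi> (Qs (r n))))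
      \<longlonglongrightarrow> dist (objective J \<pi> Q) (objective J \<pi> Q)"
    by (intro tendsto_dist objective_tendsto[OF J] conv admissible_conv_const_measure[OF conv])
  then show "\<exists>r. strict_mono r \<and> (\<lambda>n. dist (objective J (\<pi>s (s (r n))) (Qs (r n)))
      (objective J \<pi> (Qs (r n)))) \<longlonglongrightarrow> 0"
    using r by auto
qed

definition bellman :: "('a measure \<Rightarrow> real) \<Rightarrow> 'a measure \<Rightarrow> real" where
  "bellman J \<pi> = (INF Q\<in>quantizers_c M. objective J \<pi> Q)"

lemma bellman_attained:
  assumes "bounded_tv_continuous J" "\<pi> \<in> space (prob_algebra borel)"
  obtains Q where "Q \<in> quantizers_c M" "bellman J \<pi> = objective J \<pi> Q"
proof -
  obtain Q where Q: "Q \<in> quantizers_c M"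
    and "\<And>Q'. Q' \<in> quantizers_c M \<Longrightarrow> objective J \<pi> Q \<le> objective J \<pi> Q'"
    using compact_attains_inf[OF compact_objective_quantizers_c[OF assms]]
      quantizers_c_nonempty[OF M_pos] by blast
  then have "bellman J \<pi> = objective J \<pi> Q"
    unfolding bellman_def by (intro cInf_eq_minimum) auto
  then show thesis using Q that by blast
qed

lemma bounded_tv_continuous_bellman:
  assumes J: "bounded_tv_continuous J"
  shows "bounded_tv_continuous (bellman J)"
  unfolding bounded_tv_continuous_def
proof
  obtain B where B: "0 < B" "\<And>\<mu>. \<mu> \<in> dens_class C C1 \<Longrightarrow> \<bar>J \<mu>\<bar> \<le> B"
    using bounded_tv_continuous_bound[OF J] by blast
  have "\<bar>bellman J \<mu>\<bar> \<le> (1 / real T) * (real M * K) + real M * B" if "\<mu> \<in> dens_class C C1" for \<mu>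
  proof -
    have \<mu>: "\<mu> \<in> space (prob_algebra borel)" by (rule dens_class_prob[OF that])
    obtain Q where "Q \<in> quantizers_c M" "bellman J \<mu> = objective J \<mu> Q"
      by (rule bellman_attained[OF J \<mu>])
    then show ?thesis
      using abs_objective_le[OF quantizers_c_admissible[OF \<mu>] _ B(2)] B(1)
      by (simp add: less_imp_le)
  qed
  then show "bounded (bellman J ` dens_class C C1)"
    unfolding bounded_iff by auto
  show "tv_continuous_on (dens_class C C1) (bellman J)"
    unfolding tv_continuous_on_def bellman_def
  proof (intro allI ballI impI tendsto_INF_uniform_limit uniform_limit_objective J
      quantizers_c_nonempty M_pos bounded_imp_bdd_below compact_imp_bounded
      compact_objective_quantizers_c)
  qed (auto intro: dens_class_prob)
qed

lemma bounded_tv_continuous_Jrem: "bounded_tv_continuous (Jrem M c0 U \<phi> T n)"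
proof (induction n)
  case 0
  have "bounded (Jrem M c0 U \<phi> T 0 ` dens_class C C1)" by (auto intro: boundedI[of _ 0])
  then show ?case by (simp add: bounded_tv_continuous_def tv_continuous_on_def)
next
  case (Suc n)
  then show ?case
    using bounded_tv_continuous_bellman[of "Jrem M c0 U \<phi> T n"] by (simp add: bellman_def[abs_def])
qed

lemma JT_attained:
  assumes "t < T" "\<pi> \<in> space (prob_algebra borel)"
  shows "\<exists>Q\<in>quantizers_c M. JT M c0 U \<phi> T t \<pi> = objective (JT M c0 U \<phi> T (t + 1)) \<pi> Q"
proof -
  have "T - t = Suc (T - (t + 1))" using assms(1) by simp
  then have "JT M c0 U \<phi> T t \<pi> = bellman (JT M c0 U \<phi> T (t + 1)) \<pi>"
    by (simp only: JT_def Jrem.simps bellman_def)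
  then show ?thesis
    using bellman_attained[OF bounded_tv_continuous_Jrem assms(2)] unfolding JT_def by metis
qed

lemma JT_weakly_continuous:
  assumes "\<pi> \<in> dens_class C C1" "\<And>n. \<pi>s n \<in> dens_class C C1" "weak_conv_seq \<pi>s \<pi>"
  shows "(\<lambda>n. JT M c0 U \<phi> T t (\<pi>s n)) \<longlonglongrightarrow> JT M c0 U \<phi> T t \<pi>"
proof (rule tv_continuous_onD)
  show "tv_continuous_on (dens_class C C1) (JT M c0 U \<phi> T t)"
    using bounded_tv_continuous_Jrem by (simp add: JT_def bounded_tv_continuous_def)
  show "tv_conv \<pi>s \<pi>" by (rule weak_conv_imp_tv_conv[OF assms])
qed (use assms in auto)

end

section \<open>Existence of optimal quantizers\<close>

lemma lipschitz_kernel_random_map: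
  fixes f :: "'a::euclidean_space \<Rightarrow> 'a \<Rightarrow> 'a"
  assumes W: "prob_space W" "sets W = sets borel"
    and f: "(\<lambda>(x, w). f x w) \<in> borel_measurable (borel \<Otimes>\<^sub>M borel)"
    and law: "\<And>x. distr W borel (f x) = real_density (\<phi> x)"
    and \<phi>: "\<And>x z. 0 \<le> \<phi> x z" "\<And>x z. \<phi> x z \<le> C" "\<And>x z z'. \<bar>\<phi> x z - \<phi> x z'\<bar> \<le> C1 * dist z z'"
  shows "lipschitz_kernel \<phi> C C1"
proof -
  have "W \<in> space (prob_algebra borel)" using W by (simp add: space_prob_algebra)
  then have \<kappa>: "(\<lambda>x. distr W borel (f x)) \<in> borel \<rightarrow>\<^sub>M prob_algebra borel"
    using f by (intro measurable_distr_prob_space2[where M = borel] measurable_const)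
  have lip: "C1-lipschitz_on UNIV (\<phi> x)" for x
    using \<phi>(3) by (simp add: lipschitz_on_UNIV_iff dist_real_def)
  have "(\<lambda>(x, z). \<phi> x z) \<in> borel_measurable (borel \<Otimes>\<^sub>M borel)"
    by (rule lipschitz_kernel_density_measurable[OF measurable_prob_algebraD[OF \<kappa>] law lip \<phi>(1)])
  moreover have "prob_space (real_density (\<phi> x))" for x
    using measurable_space[OF \<kappa>, of x] by (simp add: space_prob_algebra law)
  ultimately show ?thesis
    using \<phi>(1,2) lip by (rule lipschitz_kernel.intro)
qed

lemma bounded_continuous_sections_bounded_borel:
  fixes c :: "'a::topological_space \<Rightarrow> 'u::topological_space \<Rightarrow> real"
  assumes "bounded ((\<lambda>(x, u). c x u) ` (UNIV \<times> U))" "continuous_on (UNIV \<times> U) (\<lambda>(x, u). c x u)"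
  obtains K where "\<forall>u\<in>U. (\<lambda>x. c x u) \<in> bounded_borel K"
proof -
  obtain K where "\<And>x u. u \<in> U \<Longrightarrow> \<bar>c x u\<bar> \<le> K"
    using assms(1) unfolding bounded_iff by force
  moreover have "(\<lambda>x. c x u) \<in> borel_measurable borel" if "u \<in> U" for u
  proof (rule borel_measurable_continuous_onI)
    show "continuous_on UNIV (\<lambda>x. c x u)"
      using continuous_on_compose2[OF assms(2), of UNIV "\<lambda>x. (x, u)"] that
      by (simp add: image_subset_iff continuous_on_Pair)
  qed
  ultimately have "\<forall>u\<in>U. (\<lambda>x. c x u) \<in> bounded_borel K"
    by (simp add: bounded_borel_def)
  then show thesis by (rule that)
qed

theorem theorem10:
  fixes f :: "'a::euclidean_space \<Rightarrow> 'a \<Rightarrow> 'a" and W :: "'a measure"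
    and \<phi> :: "'a \<Rightarrow> 'a \<Rightarrow> real" and C C1 :: real
    and c0 :: "'a \<Rightarrow> 'u::metric_space \<Rightarrow> real" and U :: "'u set"
    and M T :: nat and \<pi>0 :: "'a measure"
  assumes W: "prob_space W" "sets W = sets borel"
    and f_meas: "(\<lambda>(x, w). f x w) \<in> borel_measurable (borel \<Otimes>\<^sub>M borel)"
    and f_law: "\<forall>x. distr W borel (f x) = density lborel (\<lambda>z. ennreal (\<phi> x z))"
    and \<phi>_pos: "\<forall>x z. 0 < \<phi> x z"
    and \<phi>_bdd: "\<forall>x z. \<phi> x z \<le> C"
    and \<phi>_lip: "\<forall>x z z'. \<bar>\<phi> x z - \<phi> x z'\<bar> \<le> C1 * dist z z'"
    and c0_nonneg: "\<forall>x. \<forall>u\<in>U. 0 \<le> c0 x u"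
    and c0_bdd: "bounded ((\<lambda>(x, u). c0 x u) ` (UNIV \<times> U))"
    and c0_cont: "continuous_on (UNIV \<times> U) (\<lambda>(x, u). c0 x u)"
    and U: "compact U" "U \<noteq> {}"
    and M: "M \<ge> 1"
    and T: "T \<ge> 1"
    and \<pi>0: "prob_space \<pi>0" "sets \<pi>0 = sets borel"
      "(\<exists>g. g \<in> borel_measurable lborel \<and> \<pi>0 = density lborel g) \<or> (\<exists>x0. \<pi>0 = return borel x0)"
  shows "(\<forall>t\<in>{1..<T}. \<forall>\<pi>\<in>dens_class C C1. \<exists>Q\<in>quantizers_c M.
            JT M c0 U \<phi> T t \<pi> = stage_obj M c0 U \<phi> T (JT M c0 U \<phi> T (t + 1)) \<pi> Q)
       \<and> (\<forall>\<pi>\<in>dens_class C C1 \<union> {\<pi>0}. \<exists>Q\<in>quantizers_c M.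
            JT M c0 U \<phi> T 0 \<pi> = stage_obj M c0 U \<phi> T (JT M c0 U \<phi> T 1) \<pi> Q)
       \<and> (\<forall>t\<le>T. \<forall>\<pi>\<in>dens_class C C1. \<forall>\<pi>s.
            (\<forall>n. \<pi>s n \<in> dens_class C C1) \<and> weak_conv_seq \<pi>s \<pi> \<longrightarrow>
            (\<lambda>n. JT M c0 U \<phi> T t (\<pi>s n)) \<longlonglongrightarrow> JT M c0 U \<phi> T t \<pi>)"
proof -
  obtain K where K: "\<forall>u\<in>U. (\<lambda>x. c0 x u) \<in> bounded_borel K"
    by (rule bounded_continuous_sections_bounded_borel[OF c0_bdd c0_cont])
  interpret lipschitz_kernel \<phi> C C1
    by (rule lipschitz_kernel_random_map[OF W f_meas])
      (use f_law \<phi>_pos \<phi>_bdd \<phi>_lip in \<open>simp_all add: less_imp_le\<close>)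
  interpret quantized_control \<phi> C C1 c0 U K M T
    using K U(2) M by unfold_locales auto
  have prob: "\<pi> \<in> space (prob_algebra borel)" if "\<pi> \<in> dens_class C C1 \<union> {\<pi>0}" for \<pi>
    using that dens_class_prob[of \<pi> C C1] \<pi>0(1,2) by (auto simp: space_prob_algebra)
  show ?thesis
  proof (intro conjI ballI allI impI)
    show "\<exists>Q\<in>quantizers_c M. JT M c0 U \<phi> T t \<pi> = stage_obj M c0 U \<phi> T (JT M c0 U \<phi> T (t + 1)) \<pi> Q"
      if "t \<in> {1..<T}" "\<pi> \<in> dens_class C C1" for t \<pi>
      using that by (intro JT_attained prob) auto
    show "\<exists>Q\<in>quantizers_c M. JT M c0 U \<phi> T 0 \<pi> = stage_obj M c0 U \<phi> T (JT M c0 U \<phi> T 1) \<pi> Q"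
      if "\<pi> \<in> dens_class C C1 \<union> {\<pi>0}" for \<pi>
      using JT_attained[OF _ prob[OF that], of 0] T by simp
    show "(\<lambda>n. JT M c0 U \<phi> T t (\<pi>s n)) \<longlonglongrightarrow> JT M c0 U \<phi> T t \<pi>"
      if "\<pi> \<in> dens_class C C1" "(\<forall>n. \<pi>s n \<in> dens_class C C1) \<and> weak_conv_seq \<pi>s \<pi>" for t \<pi> \<pi>s
      using that by (intro JT_weakly_continuous) auto
  qed
qed

end
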